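(* For every $n\ge1$, $D_n^{S_n}\cong D_n$.
   Context: Let $\Bbbk$ be an algebraically closed field of characteristic $0$. The $n$-th Weyl algebra $A_n$ over $\Bbbk$ is generated by $x_1,\dots,x_n,\partial_1,\dots,\partial_n$ subject to $$x_ix_j=x_jx_i,\qquad \partial_i\partial_j=\partial_j\partial_i,\qquad \partial_ix_j-x_j\partial_i=\delta_{ij}.$$ $D_n$ denotes its skew field of fractions. The symmetric group $S_n$ acts on $A_n$, and hence on $D_n$, by simultaneously permuting the $x_i$ and the $\partial_i$: $\sigma(x_i)=x_{\sigma(i)}$ and $\sigma(\partial_i)=\partial_{\sigma(i)}$. $D_n^{S_n}$ is the subfield of invariants. *)

theory Defs
  imports "HOL-Combinatorics.Permutations" "HOL-Computational_Algebra.Polynomial" "HOL-Algebra.QuotRing"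
begin

definition alg_closed_type :: "'a::field itself \<Rightarrow> bool" where
  "alg_closed_type _ \<longleftrightarrow> (\<forall>p::'a poly. degree p > 0 \<longrightarrow> (\<exists>x. poly p x = 0))"

text \<open>Concrete model of the Weyl algebra A_n: the algebra of operators on formal
  power series in the variables x_0, x_1, ... (coefficient functions indexed by
  exponent vectors nat => nat) generated by the scalars, multiplication by x_i and
  the partial derivatives d_i, for i < n.  Variables are indexed 0..n-1.\<close>

type_synonym 'a series = "(nat \<Rightarrow> nat) \<Rightarrow> 'a"
type_synonym 'a op = "'a series \<Rightarrow> 'a series"

definition mulX :: "nat \<Rightarrow> 'a::field op" where
  "mulX i f = (\<lambda>\<alpha>. if 0 < \<alpha> i then f (\<alpha>(i := \<alpha> i - 1)) else 0)"

definition pderivD :: "nat \<Rightarrow> 'a::field op" where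
  "pderivD i f = (\<lambda>\<alpha>. of_nat (\<alpha> i + 1) * f (\<alpha>(i := \<alpha> i + 1)))"

definition scal_op :: "'a::field \<Rightarrow> 'a op" where
  "scal_op c f = (\<lambda>\<alpha>. c * f \<alpha>)"

definition add_op :: "'a::field op \<Rightarrow> 'a op \<Rightarrow> 'a op" where
  "add_op S T f = (\<lambda>\<alpha>. S f \<alpha> + T f \<alpha>)"

inductive_set weyl_ops :: "nat \<Rightarrow> 'a::field op set" for n where
  scal: "scal_op c \<in> weyl_ops n"
| genX: "i < n \<Longrightarrow> mulX i \<in> weyl_ops n"
| genD: "i < n \<Longrightarrow> pderivD i \<in> weyl_ops n"
| add: "S \<in> weyl_ops n \<Longrightarrow> T \<in> weyl_ops n \<Longrightarrow> add_op S T \<in> weyl_ops n"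
| comp: "S \<in> weyl_ops n \<Longrightarrow> T \<in> weyl_ops n \<Longrightarrow> S \<circ> T \<in> weyl_ops n"

definition weyl_algebra :: "nat \<Rightarrow> 'a::field op ring" where
  "weyl_algebra n = \<lparr> carrier = weyl_ops n, mult = (\<circ>), one = id,
                      zero = scal_op 0, add = add_op \<rparr>"

definition division_ring :: "('b, 'c) ring_scheme \<Rightarrow> bool" where
  "division_ring D \<longleftrightarrow> ring D \<and> \<one>\<^bsub>D\<^esub> \<noteq> \<zero>\<^bsub>D\<^esub> \<and>
     (\<forall>d \<in> carrier D. d \<noteq> \<zero>\<^bsub>D\<^esub> \<longrightarrow> d \<in> Units D)"

definition skew_field_of_fractions ::
  "('a, 'x) ring_scheme \<Rightarrow> ('b, 'c) ring_scheme \<Rightarrow> ('a \<Rightarrow> 'b) \<Rightarrow> bool" where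
  "skew_field_of_fractions A D \<iota> \<longleftrightarrow> ring A \<and> division_ring D \<and> \<iota> \<in> ring_hom A D \<and>
     inj_on \<iota> (carrier A) \<and>
     (\<forall>d \<in> carrier D. \<exists>a \<in> carrier A. \<exists>b \<in> carrier A.
         \<iota> b \<noteq> \<zero>\<^bsub>D\<^esub> \<and> d = \<iota> a \<otimes>\<^bsub>D\<^esub> inv\<^bsub>D\<^esub> (\<iota> b))"

text \<open>The S_n-invariants of D_n: elements fixed by the (unique) k-linear ring endomorphism
  h of D_n extending the automorphism x_i -> x_(sigma i), d_i -> d_(sigma i) of A_n,
  for every permutation sigma of {0..<n}.\<close>
definition sym_invariants ::
  "nat \<Rightarrow> ('b, 'c) ring_scheme \<Rightarrow> ('a::field op \<Rightarrow> 'b) \<Rightarrow> 'b set" where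
  "sym_invariants n D \<iota> = {d \<in> carrier D. \<forall>\<sigma>. \<sigma> permutes {0..<n} \<longrightarrow>
      (\<forall>h \<in> ring_hom D D.
         (\<forall>c. h (\<iota> (scal_op c)) = \<iota> (scal_op c)) \<and>
         (\<forall>i<n. h (\<iota> (mulX i)) = \<iota> (mulX (\<sigma> i)) \<and> h (\<iota> (pderivD i)) = \<iota> (pderivD (\<sigma> i)))
         \<longrightarrow> h d = d)}"

definition k_algebra_iso ::
  "('a::field \<Rightarrow> 'b) \<Rightarrow> ('b, 'c) ring_scheme \<Rightarrow> ('a \<Rightarrow> 'd) \<Rightarrow> ('d, 'e) ring_scheme \<Rightarrow> bool" where
  "k_algebra_iso e1 R e2 S \<longleftrightarrow> (\<exists>\<phi> \<in> ring_iso R S. \<forall>c. \<phi> (e1 c) = e2 c)"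

end

(* Let x_j, d_j be the generators in D, and let y_m = (x_1^(m+1) + ... + x_n^(m+1))/(m+1).  Solving the
   Vandermonde system sum_i x_j^i b_i = d_j (for all j) inside D yields elements b_i; since [d_j, y_m] = x_j^m,
   uniqueness of the solution gives [b_i, y_m] = delta_im, [b_i, b_m] = 0 and the invariance of the b_i.
   Hence x_m -> y_m, d_m -> b_m extends to an embedding of D into itself whose image L consists of
   invariants.

   Conversely, L contains all power sums of the x_j by Newton's identities.  Because
   sum_j r_j d_j = sum_i (sum_j r_j x_j^i) b_i for every word r in x, d, it contains by induction on the
   degree in d all polarised power sums sum_j r_j, and therefore the trace over S_n of every element of A_n.
   Finally, if z is invariant, the elements w of A_n with z w in A_n form an S_n-stable nonzero right ideal;
   a Vandermonde argument gives a nonzero trace s in it, both s and z s are traces, so z = (z s) s^(-1) lies in L. *)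

theory Submission
  imports Defs
begin

section \<open>Skew fields over a field of characteristic zero\<close>

text \<open>The linear system for the \<open>b i\<close> is the chain rule. With the
  \<open>y i\<close> as new coordinates, d/dx_j is the sum over i of (dy_i/dx_j) d/dy_i, and the
  factor 1/(m+1) makes dy_m/dx_j exactly x_j^m, so the matrix is Vandermonde. Thus
  \<open>b i\<close> is the derivative along \<open>y i\<close>; its denominators are differences of
  the x_j, which is why it lies in D and in general not in A_n. The obstacle is that only the
  relations in \<open>D\<close> and the form of its elements as right fractions are at hand, neither
  a basis of A_n nor a universal property. To define a homomorphism, the proof takes all pairs got
  by evaluating one expression in two Weyl systems and shows that they form the graph of a map. Both
  entries of a pair are brought to normal order by the same rewriting, and commutators, acting as
  derivatives, extract the coefficients of an expression that vanishes. Characteristic zero first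
  enters here; later it allows division by degrees and by numbers of free slots. The use of traces
  avoids computing the degree of an extension of skew fields.\<close>

locale skew_alg = ring D for D (structure) +
  fixes k :: "'k::field_char_0 \<Rightarrow> 'b"
  assumes nontrivial: "\<one> \<noteq> \<zero>"
    and units: "\<lbrakk>a \<in> carrier D; a \<noteq> \<zero>\<rbrakk> \<Longrightarrow> a \<in> Units D"
    and k_closed [simp, intro]: "k c \<in> carrier D"
    and k_add: "k (c + c') = k c \<oplus> k c'"
    and k_mult: "k (c * c') = k c \<otimes> k c'"
    and k_one [simp]: "k 1 = \<one>"
    and k_central: "a \<in> carrier D \<Longrightarrow> k c \<otimes> a = a \<otimes> k c"
begin

definition ad :: "'b \<Rightarrow> 'b \<Rightarrow> 'b" where
  "ad z p = z \<otimes> p \<ominus> p \<otimes> z"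

lemma k_zero [simp]: "k 0 = \<zero>"
  by (metis add.l_cancel_one' add_cancel_left_right k_add k_closed)

lemma k_uminus: "k (- c) = \<ominus> k c"
  by (metis add.inv_equality k_add k_closed k_zero neg_eq_iff_add_eq_0 minus_minus)

lemma k_nonzero: "c \<noteq> 0 \<Longrightarrow> k c \<noteq> \<zero>"
  using k_mult[of c "inverse c"] nontrivial by auto

lemma k_eq_iff: "k c = k c' \<longleftrightarrow> c = c'"
proof
  assume "k c = k c'"
  then have "k (c - c') = \<zero>"
    using k_add[of c "- c'"] by (simp add: k_uminus r_neg)
  then show "c = c'" using k_nonzero[of "c - c'"] by auto
qed simp

lemma k_Suc: "k (of_nat (Suc m)) = k (of_nat m) \<oplus> \<one>"
  by (metis add.commute k_add k_one of_nat_Suc)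

lemma k_left_commute:
  "\<lbrakk>a \<in> carrier D; b \<in> carrier D\<rbrakk> \<Longrightarrow> a \<otimes> (k c \<otimes> b) = k c \<otimes> (a \<otimes> b)"
  by (metis k_central k_closed m_assoc)

lemma mult_eq_zero_iff:
  assumes "a \<in> carrier D" "b \<in> carrier D"
  shows "a \<otimes> b = \<zero> \<longleftrightarrow> a = \<zero> \<or> b = \<zero>"
proof
  assume ab: "a \<otimes> b = \<zero>"
  show "a = \<zero> \<or> b = \<zero>"
  proof (rule disjCI)
    assume "b \<noteq> \<zero>"
    then have u: "b \<in> Units D" using assms units by blast
    have "a = (a \<otimes> b) \<otimes> inv b" using u assms by (simp add: m_assoc)
    then show "a = \<zero>" using ab u by simp
  qed
qed (use assms in auto)

lemma right_cancel:
  assumes "a \<in> carrier D" "b \<in> carrier D" "c \<in> carrier D" "c \<noteq> \<zero>" "a \<otimes> c = b \<otimes> c"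
  shows "a = b"
  using assms units by (metis Units_closed Units_inv_closed Units_r_inv m_assoc r_one)

lemma add_diff_telescope:
  "\<lbrakk>a \<in> carrier D; b \<in> carrier D; c \<in> carrier D\<rbrakk> \<Longrightarrow> (a \<ominus> b) \<oplus> (b \<ominus> c) = a \<ominus> c"
  by (metis a_assoc add.inv_closed add.m_closed minus_eq r_neg1)

lemma diff_self [simp]: "a \<in> carrier D \<Longrightarrow> a \<ominus> a = \<zero>"
  by (simp add: minus_eq r_neg)

lemma diff_eq_zero_iff:
  "\<lbrakk>a \<in> carrier D; b \<in> carrier D\<rbrakk> \<Longrightarrow> a \<ominus> b = \<zero> \<longleftrightarrow> a = b"
  by (metis diff_self add.inv_closed add.inv_equality minus_eq minus_minus)

lemma left_diff_distrib:
  "\<lbrakk>a \<in> carrier D; b \<in> carrier D; c \<in> carrier D\<rbrakk> \<Longrightarrow> (a \<ominus> b) \<otimes> c = a \<otimes> c \<ominus> b \<otimes> c"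
  by (simp add: minus_eq l_distr l_minus)

lemma right_diff_distrib:
  "\<lbrakk>a \<in> carrier D; b \<in> carrier D; c \<in> carrier D\<rbrakk> \<Longrightarrow> c \<otimes> (a \<ominus> b) = c \<otimes> a \<ominus> c \<otimes> b"
  by (simp add: minus_eq r_distr r_minus)

section \<open>Commutators as derivations\<close>

lemma ad_closed [simp, intro]:
  "\<lbrakk>z \<in> carrier D; p \<in> carrier D\<rbrakk> \<Longrightarrow> ad z p \<in> carrier D"
  by (simp add: ad_def)

lemma ad_eq_zero_iff:
  "\<lbrakk>z \<in> carrier D; p \<in> carrier D\<rbrakk> \<Longrightarrow> ad z p = \<zero> \<longleftrightarrow> z \<otimes> p = p \<otimes> z"
  by (simp add: ad_def diff_eq_zero_iff)

lemma commute_ad: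
  "\<lbrakk>z \<in> carrier D; p \<in> carrier D\<rbrakk> \<Longrightarrow> z \<otimes> p = p \<otimes> z \<oplus> ad z p"
  by (metis ad_def a_comm add.inv_closed m_closed minus_eq r_neg2 a_assoc)

lemma ad_eqI:
  "\<lbrakk>z \<in> carrier D; p \<in> carrier D; q \<in> carrier D; z \<otimes> p = p \<otimes> z \<oplus> q\<rbrakk> \<Longrightarrow> ad z p = q"
  by (metis ad_closed commute_ad r_neg1 m_closed)

lemma ad_mult:
  assumes "z \<in> carrier D" "p \<in> carrier D" "q \<in> carrier D"
  shows "ad z (p \<otimes> q) = ad z p \<otimes> q \<oplus> p \<otimes> ad z q"
  using add_diff_telescope[of "z \<otimes> p \<otimes> q" "p \<otimes> z \<otimes> q" "p \<otimes> q \<otimes> z"] assms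
  by (simp add: ad_def left_diff_distrib right_diff_distrib m_assoc)

lemma ad_add:
  assumes "z \<in> carrier D" "p \<in> carrier D" "q \<in> carrier D"
  shows "ad z (p \<oplus> q) = ad z p \<oplus> ad z q"
  using assms by (simp add: ad_def minus_eq l_distr r_distr minus_add a_ac)

lemma ad_add_left:
  assumes "z \<in> carrier D" "p \<in> carrier D" "q \<in> carrier D"
  shows "ad (p \<oplus> q) z = ad p z \<oplus> ad q z"
  using assms by (simp add: ad_def minus_eq l_distr r_distr minus_add a_ac)

lemma ad_swap: "\<lbrakk>z \<in> carrier D; p \<in> carrier D\<rbrakk> \<Longrightarrow> ad z p = \<ominus> ad p z"
  by (simp add: ad_def minus_eq minus_add a_ac)

lemma ad_uminus_left: "\<lbrakk>z \<in> carrier D; p \<in> carrier D\<rbrakk> \<Longrightarrow> ad (\<ominus> z) p = \<ominus> ad z p"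
  by (simp add: ad_def minus_eq minus_add l_minus r_minus)

lemma ad_k [simp]: "z \<in> carrier D \<Longrightarrow> ad z (k c) = \<zero>"
  by (simp add: ad_eq_zero_iff k_central)

lemma ad_one [simp]: "z \<in> carrier D \<Longrightarrow> ad z \<one> = \<zero>"
  by (simp add: ad_eq_zero_iff)

lemma ad_zero [simp]: "z \<in> carrier D \<Longrightarrow> ad z \<zero> = \<zero>"
  by (simp add: ad_eq_zero_iff)

lemma ad_finsum:
  assumes "z \<in> carrier D" "f \<in> A \<rightarrow> carrier D"
  shows "ad z (\<Oplus>i\<in>A. f i) = (\<Oplus>i\<in>A. ad z (f i))"
  using assms(2)
proof (induction A rule: infinite_finite_induct)
  case (insert a A)
  then have "(\<lambda>i. ad z (f i)) \<in> A \<rightarrow> carrier D" using assms(1) by auto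
  with insert assms(1) show ?case by (simp add: ad_add)
qed (use assms(1) in auto)

text \<open>In the Leibniz rule the \<open>m\<close> summands coincide because \<open>ad z g\<close>
  commutes with \<open>g\<close>. For \<open>m = 0\<close> the truncated exponent
  \<open>m - 1\<close> is harmless: the factor \<open>k 0\<close> vanishes.\<close>

lemma ad_pow:
  assumes "z \<in> carrier D" "g \<in> carrier D" "ad z g \<otimes> g = g \<otimes> ad z g"
  shows "ad z (g [^] (m::nat)) = k (of_nat m) \<otimes> g [^] (m - 1) \<otimes> ad z g"
proof (induction m)
  case (Suc m)
  show ?case
  proof (cases m)
    case 0
    then show ?thesis using assms by simp
  next
    case (Suc l)
    have c: "g [^] l \<otimes> ad z g \<otimes> g = g [^] m \<otimes> ad z g"
      using Suc assms by (simp add: m_assoc)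
    have IH: "ad z (g [^] m) = k (of_nat m) \<otimes> (g [^] l \<otimes> ad z g)"
      using Suc.IH Suc assms by (simp add: m_assoc)
    have "ad z (g [^] Suc m) = ad z (g [^] m) \<otimes> g \<oplus> g [^] m \<otimes> ad z g"
      using assms by (simp add: ad_mult)
    then have "ad z (g [^] Suc m) = k (of_nat m) \<otimes> (g [^] l \<otimes> ad z g \<otimes> g) \<oplus> g [^] m \<otimes> ad z g"
      unfolding IH using assms by (simp add: m_assoc)
    also have "\<dots> = (k (of_nat m) \<oplus> \<one>) \<otimes> (g [^] m \<otimes> ad z g)"
      using assms by (simp add: c l_distr)
    also have "\<dots> = k (of_nat (Suc m)) \<otimes> g [^] m \<otimes> ad z g"
      using assms by (simp add: k_add a_comm m_assoc)
    finally show ?thesis by simp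
  qed
qed (use assms in simp)

section \<open>Normally ordered expressions\<close>

text \<open>Applying \<^term>\<open>ad z\<close>, which acts as $d/dg$, lowers the degree.\<close>

lemma power_sum_eq_zeroD:
  fixes m :: nat
  assumes "z \<in> carrier D" "g \<in> carrier D" "ad z g = \<one>"
    and "\<And>a. a \<le> m \<Longrightarrow> u a \<in> carrier D" "\<And>a. a \<le> m \<Longrightarrow> ad z (u a) = \<zero>"
    and "(\<Oplus>a\<in>{..m}. u a \<otimes> g [^] a) = \<zero>" "a \<le> m"
  shows "u a = \<zero>"
  using assms(4-)
proof (induction m arbitrary: u a)
  case (Suc m)
  \<comment> \<open>Coefficients of the derivative with respect to \<open>g\<close>. By induction
    they vanish; division by \<open>Suc a\<close> then kills every \<open>u (Suc a)\<close>, and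
    only the constant coefficient is left.\<close>
  define v where "v a = k (of_nat (Suc a)) \<otimes> u (Suc a)" for a
  have uc: "u a \<in> carrier D" if "a \<le> Suc m" for a using Suc.prems(1) that .
  have ad_term: "ad z (u (Suc a) \<otimes> g [^] Suc a) = v a \<otimes> g [^] a" if "a \<le> m" for a
  proof -
    have "ad z (u (Suc a) \<otimes> g [^] Suc a) = u (Suc a) \<otimes> ad z (g [^] Suc a)"
      using that ad_mult[of z "u (Suc a)" "g [^] Suc a"] Suc.prems(2)[of "Suc a"]
        uc[of "Suc a"] assms(1,2) by simp
    also have "ad z (g [^] Suc a) = k (of_nat (Suc a)) \<otimes> g [^] a"
      using ad_pow[of z g "Suc a"] assms(1-3) by simp
    finally show ?thesis
      using that uc[of "Suc a"] assms(2) unfolding v_def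
      by (simp add: k_left_commute m_assoc del: of_nat_Suc)
  qed
  have s: "(\<Oplus>a\<in>{..Suc m}. u a \<otimes> g [^] a) =
      (\<Oplus>a\<in>{..m}. u (Suc a) \<otimes> g [^] Suc a) \<oplus> u 0 \<otimes> g [^] (0::nat)"
    by (rule add.finprod_Suc2) (use uc assms(2) in auto)
  have "\<zero> = ad z (\<Oplus>a\<in>{..Suc m}. u a \<otimes> g [^] a)"
    using Suc.prems(3) assms(1) by simp
  also have "\<dots> = ad z (\<Oplus>a\<in>{..m}. u (Suc a) \<otimes> g [^] Suc a) \<oplus> ad z (u 0)"
    unfolding s using uc assms(1,2)
    by (subst ad_add) (auto intro!: finsum_closed simp del: nat_pow_Suc)
  also have "\<dots> = (\<Oplus>a\<in>{..m}. ad z (u (Suc a) \<otimes> g [^] Suc a))"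
    using Suc.prems(2)[of 0] uc assms(1,2)
    by (subst ad_finsum) (auto intro!: finsum_closed simp del: nat_pow_Suc)
  also have "\<dots> = (\<Oplus>a\<in>{..m}. v a \<otimes> g [^] a)"
    using ad_term uc assms(2) by (intro finsum_cong') (auto simp: v_def simp del: nat_pow_Suc of_nat_Suc)
  finally have vs: "(\<Oplus>a\<in>{..m}. v a \<otimes> g [^] a) = \<zero>" by simp
  have "v a = \<zero>" if "a \<le> m" for a
  proof (rule Suc.IH[OF _ _ vs that])
    fix a assume "a \<le> m"
    then show "v a \<in> carrier D" "ad z (v a) = \<zero>"
      using uc[of "Suc a"] Suc.prems(2)[of "Suc a"] assms(1) unfolding v_def
      by (simp_all add: ad_mult del: of_nat_Suc)
  qed
  then have pos: "u (Suc a) = \<zero>" if "a \<le> m" for a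
    using that uc[of "Suc a"] k_nonzero[of "of_nat (Suc a) :: 'k"]
      mult_eq_zero_iff[of "k (of_nat (Suc a))" "u (Suc a)"]
    unfolding v_def by (auto simp del: of_nat_Suc)
  have "(\<Oplus>a\<in>{..m}. u (Suc a) \<otimes> g [^] Suc a) = (\<Oplus>a\<in>{..m}. \<zero>)"
    by (rule finsum_cong') (use assms(2) in \<open>auto simp: pos simp del: nat_pow_Suc\<close>)
  then have "u 0 = \<zero>"
    using s Suc.prems(3) uc[of 0] by simp
  then show ?case using pos Suc.prems(4) by (cases a) auto
qed simp

text \<open>\<^term>\<open>nf g g' j\<close> relates a normally ordered expression in \<^term>\<open>g 0\<close>, ...,
  \<^term>\<open>g (j - 1)\<close> to the same expression in the \<^term>\<open>g'\<close>.\<close>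

inductive nf :: "(nat \<Rightarrow> 'b) \<Rightarrow> (nat \<Rightarrow> 'b) \<Rightarrow> nat \<Rightarrow> 'b \<Rightarrow> 'b \<Rightarrow> bool" for g g' where
  scalar: "nf g g' 0 (k c) (k c)"
| power: "nf g g' j u u' \<Longrightarrow> nf g g' (Suc j) (u \<otimes> g j [^] a) (u' \<otimes> g' j [^] (a::nat))"
| sum: "nf g g' (Suc j) p p' \<Longrightarrow> nf g g' (Suc j) q q' \<Longrightarrow> nf g g' (Suc j) (p \<oplus> q) (p' \<oplus> q')"

text \<open>Commutators are scalars, so moving one generator past a power of another leaves a single
  lower term. The last clause supplies a derivative in \<open>g i\<close> that kills the earlier
  generators; this suffices because normal forms are taken apart from the highest index
  downwards.\<close>

definition triangular_gens :: "nat \<Rightarrow> (nat \<Rightarrow> 'b) \<Rightarrow> (nat \<Rightarrow> nat \<Rightarrow> 'k) \<Rightarrow> bool" where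
  "triangular_gens m g \<epsilon> \<longleftrightarrow> (\<forall>i<m. g i \<in> carrier D) \<and>
     (\<forall>i<m. \<forall>l<i. ad (g i) (g l) = k (\<epsilon> i l)) \<and>
     (\<forall>i<m. \<exists>z\<in>carrier D. ad z (g i) = \<one> \<and> (\<forall>l<i. ad z (g l) = \<zero>))"

lemma triangular_gensD:
  assumes "triangular_gens m g \<epsilon>" "i < m"
  shows "g i \<in> carrier D" "\<And>l. l < i \<Longrightarrow> ad (g i) (g l) = k (\<epsilon> i l)"
    "\<exists>z\<in>carrier D. ad z (g i) = \<one> \<and> (\<forall>l<i. ad z (g l) = \<zero>)"
  using assms by (auto simp: triangular_gens_def)

lemma nf_swap: "nf g g' j p p' \<Longrightarrow> nf g' g j p' p"
  by (induction rule: nf.induct) (auto intro: nf.intros)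

lemma nf_closed:
  assumes "nf g g' j p p'" "\<And>i. i < j \<Longrightarrow> g i \<in> carrier D"
  shows "p \<in> carrier D"
  using assms by (induction rule: nf.induct) auto

lemma nf_scalar:
  assumes "nf g g' j p p'" "\<And>i. i < j \<Longrightarrow> g i \<in> carrier D" "\<And>i. i < j \<Longrightarrow> g' i \<in> carrier D"
  shows "nf g g' j (k c \<otimes> p) (k c \<otimes> p')"
  using assms
proof (induction rule: nf.induct)
  case (scalar c')
  then show ?case by (metis k_mult nf.scalar)
next
  case (power j u u' a)
  have "u \<in> carrier D" "u' \<in> carrier D"
    using power nf_closed nf_closed[OF nf_swap] by auto
  with power show ?case by (metis m_assoc nf.power k_closed less_Suc_eq nat_pow_closed)
next
  case (sum j p p' q q')
  have "p \<in> carrier D" "p' \<in> carrier D" "q \<in> carrier D" "q' \<in> carrier D"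
    using sum nf_closed nf_closed[OF nf_swap] by meson+
  with sum show ?case by (simp add: r_distr nf.sum)
qed

lemma nf_k: "nf g g' j (k c) (k c)" if "\<And>i. i < j \<Longrightarrow> g i \<in> carrier D" "\<And>i. i < j \<Longrightarrow> g' i \<in> carrier D"
  using that
proof (induction j)
  case (Suc j)
  then show ?case using nf.power[of g g' j "k c" "k c" 0] by simp
qed (rule nf.scalar)

lemma nf_sum: "nf g g' j p p' \<Longrightarrow> nf g g' j q q' \<Longrightarrow> nf g g' j (p \<oplus> q) (p' \<oplus> q')"
proof (cases j)
  case 0
  assume "nf g g' j p p'" "nf g g' j q q'"
  then obtain c c' where "p = k c" "p' = k c" "q = k c'" "q' = k c'"
    unfolding 0 by (auto elim!: nf.cases[of g g' 0])
  then show ?thesis using nf.scalar[of g g' "c + c'"] 0 by (simp add: k_add)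
qed (auto intro: nf.sum)

text \<open>A derivation of \<open>nf\<close> may use the same power of \<open>g j\<close> in
  several summands; collecting them gives one coefficient per exponent, paired with its counterpart
  on the other side. The sums are claimed for every bound \<open>l \<ge> m\<close> so that
  expressions of different degree can be added.\<close>

lemma nf_coeffs:
  assumes "nf g g' (Suc j) p p'" "\<And>i. i < Suc j \<Longrightarrow> g i \<in> carrier D" "\<And>i. i < Suc j \<Longrightarrow> g' i \<in> carrier D"
  shows "\<exists>m u u'. (\<forall>a. nf g g' j (u a) (u' a)) \<and>
    (\<forall>l\<ge>m. p = (\<Oplus>a\<in>{..l::nat}. u a \<otimes> g j [^] a) \<and> p' = (\<Oplus>a\<in>{..l}. u' a \<otimes> g' j [^] a))"
  using assms
proof (induction "Suc j" p p' rule: nf.induct)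
  case (power u u' a)
  have z: "nf g g' j \<zero> \<zero>" using nf_k[of j g g' 0] power by auto
  have c: "u \<in> carrier D" "u' \<in> carrier D" "g j \<in> carrier D" "g' j \<in> carrier D"
    using power nf_closed nf_closed[OF nf_swap] by auto
  have eq: "(\<Oplus>i\<in>{..l}. (if i = a then w else \<zero>) \<otimes> h [^] i) = w \<otimes> h [^] a"
    if "w \<in> carrier D" "h \<in> carrier D" "l \<ge> a" for w h l
  proof -
    have "(\<Oplus>i\<in>{..l}. (if i = a then w else \<zero>) \<otimes> h [^] i) =
        (\<Oplus>i\<in>{..l}. if a = i then w \<otimes> h [^] i else \<zero>)"
      by (rule finsum_cong') (use that in auto)
    also have "\<dots> = w \<otimes> h [^] a"
      by (rule add.finprod_singleton) (use that in auto)
    finally show ?thesis .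
  qed
  show ?case
    by (rule exI[of _ a], rule exI[of _ "\<lambda>i. if i = a then u else \<zero>"],
        rule exI[of _ "\<lambda>i. if i = a then u' else \<zero>"]) (use z c power eq in auto)
next
  case (sum p p' q q')
  obtain m u u' where 1: "\<And>a. nf g g' j (u a) (u' a)"
    "\<And>l. l \<ge> m \<Longrightarrow> p = (\<Oplus>a\<in>{..l::nat}. u a \<otimes> g j [^] a)"
    "\<And>l. l \<ge> m \<Longrightarrow> p' = (\<Oplus>a\<in>{..l::nat}. u' a \<otimes> g' j [^] a)"
    using sum(2,5,6) by blast
  obtain n v v' where 2: "\<And>a. nf g g' j (v a) (v' a)"
    "\<And>l. l \<ge> n \<Longrightarrow> q = (\<Oplus>a\<in>{..l::nat}. v a \<otimes> g j [^] a)"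
    "\<And>l. l \<ge> n \<Longrightarrow> q' = (\<Oplus>a\<in>{..l::nat}. v' a \<otimes> g' j [^] a)"
    using sum(4,5,6) by blast
  have c: "u a \<in> carrier D" "u' a \<in> carrier D" "v a \<in> carrier D" "v' a \<in> carrier D" for a
    using nf_closed[OF 1(1)] nf_closed[OF 2(1)] nf_closed[OF nf_swap[OF 1(1)]]
      nf_closed[OF nf_swap[OF 2(1)]] sum(5,6) by auto
  have g: "g j \<in> carrier D" "g' j \<in> carrier D" using sum(5,6) by auto
  have add: "(\<Oplus>a\<in>{..l}. w a \<otimes> h [^] a) \<oplus> (\<Oplus>a\<in>{..l}. w' a \<otimes> h [^] a)
      = (\<Oplus>a\<in>{..l}. (w a \<oplus> w' a) \<otimes> h [^] a)"
    if "\<And>a. w a \<in> carrier D" "\<And>a. w' a \<in> carrier D" "h \<in> carrier D" for w w' h and l :: nat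
    using that by (subst finsum_addf[symmetric]) (auto simp: l_distr)
  show ?case
  proof (intro exI conjI allI impI)
    show "nf g g' j (u a \<oplus> v a) (u' a \<oplus> v' a)" for a
      using 1 2 nf_sum by blast
    fix l assume "l \<ge> max m n"
    then have l: "l \<ge> m" "l \<ge> n" by auto
    show "p \<oplus> q = (\<Oplus>a\<in>{..l}. (u a \<oplus> v a) \<otimes> g j [^] a)"
      unfolding 1(2)[OF l(1)] 2(2)[OF l(2)] by (rule add) (use c g in auto)
    show "p' \<oplus> q' = (\<Oplus>a\<in>{..l}. (u' a \<oplus> v' a) \<otimes> g' j [^] a)"
      unfolding 1(3)[OF l(1)] 2(3)[OF l(2)] by (rule add) (use c g in auto)
  qed
qed

lemma nf_ad_zero:
  assumes "nf g g' j p p'" "\<And>i. i < j \<Longrightarrow> g i \<in> carrier D"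
    and "z \<in> carrier D" "\<And>i. i < j \<Longrightarrow> ad z (g i) = \<zero>"
  shows "ad z p = \<zero>"
  using assms
proof (induction rule: nf.induct)
  case (power j u u' a)
  have "u \<in> carrier D" using nf_closed[OF power(1)] power(3) by auto
  moreover have "ad z (g j [^] a) = \<zero>" using ad_pow[of z "g j" a] power by auto
  ultimately show ?case using power by (simp add: ad_mult)
next
  case (sum j p p' q q')
  have "p \<in> carrier D" "q \<in> carrier D"
    using sum nf_closed by meson+
  with sum show ?case by (simp add: ad_add)
qed auto

text \<open>Some \<open>ad z\<close> is the derivative in the last generator and kills the earlier
  ones, so the coefficients of a vanishing expression vanish, and by induction so do their
  counterparts. This takes the place of linear independence of the ordered monomials.\<close>

lemma nf_zero:
  assumes "triangular_gens m g \<epsilon>" "\<And>i. i < m \<Longrightarrow> g' i \<in> carrier D"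
  shows "nf g g' j p p' \<Longrightarrow> j \<le> m \<Longrightarrow> p = \<zero> \<Longrightarrow> p' = \<zero>"
proof (induction j arbitrary: p p')
  case 0
  then obtain c where "p = k c" "p' = k c" by (auto elim: nf.cases)
  then show ?case using 0 by simp
next
  case (Suc j)
  have g: "\<And>i. i < Suc j \<Longrightarrow> g i \<in> carrier D" "\<And>i. i < Suc j \<Longrightarrow> g' i \<in> carrier D"
    using assms Suc triangular_gensD(1) by auto
  obtain l u u' where u: "\<And>a. nf g g' j (u a) (u' a)"
    "p = (\<Oplus>a\<in>{..l::nat}. u a \<otimes> g j [^] a)" "p' = (\<Oplus>a\<in>{..l}. u' a \<otimes> g' j [^] a)"
    using nf_coeffs[OF Suc.prems(1) g] by blast
  obtain z where z: "z \<in> carrier D" "ad z (g j) = \<one>" "\<And>i. i < j \<Longrightarrow> ad z (g i) = \<zero>"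
    using triangular_gensD(3)[OF assms(1), of j] Suc.prems by auto
  have "u a = \<zero>" if "a \<le> l" for a
  proof (rule power_sum_eq_zeroD[of z "g j" l u])
    show "u a \<in> carrier D" "ad z (u a) = \<zero>" for a
      using nf_closed[OF u(1)] nf_ad_zero[OF u(1)] g z by auto
  qed (use z g that u Suc.prems in auto)
  then have "u' a = \<zero>" if "a \<le> l" for a
    using Suc.IH[OF u(1)] that Suc.prems(2) by (metis Suc_leD)
  then have "p' = (\<Oplus>a\<in>{..l}. \<zero>)"
    unfolding u(3) using g by (intro finsum_cong') auto
  then show ?case by simp
qed

text \<open>Reordering after multiplication by a generator uses only the scalars
  \<open>\<epsilon>\<close>. As both families have the same \<open>\<epsilon>\<close>, the same
  rewriting applies to both sides.\<close>

lemma nf_mult_gen: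
  assumes t: "triangular_gens m g \<epsilon>" "triangular_gens m g' \<epsilon>"
  shows "nf g g' j p p' \<Longrightarrow> j \<le> m \<Longrightarrow> i < j \<Longrightarrow> nf g g' j (p \<otimes> g i) (p' \<otimes> g' i)"
proof (induction rule: nf.induct)
  case (power j u u' a)
  have g: "g l \<in> carrier D" "g' l \<in> carrier D" if "l < Suc j" for l
    using that t[THEN triangular_gensD(1)] power.prems by auto
  have u: "u \<in> carrier D" "u' \<in> carrier D"
    using nf_closed[OF power(1)] nf_closed[OF nf_swap[OF power(1)]] g by auto
  show ?case
  proof (cases "i = j")
    case True
    then show ?thesis using nf.power[OF power(1), of "Suc a"] g[of j] u by (simp add: m_assoc)
  next
    case False
    then have i: "i < j" using power by auto
    \<comment> \<open>The scalar left over when \<open>h i\<close> is moved to the left of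
      \<open>h j [^] a\<close>; it is the same for \<open>g\<close> and for
      \<open>g'\<close>.\<close>
    define c where "c = of_nat a * \<epsilon> j i"
    have eq: "w \<otimes> h j [^] a \<otimes> h i = (w \<otimes> h i) \<otimes> h j [^] a \<oplus> (k c \<otimes> w) \<otimes> h j [^] (a - 1)"
      if h: "triangular_gens m h \<epsilon>" and w: "w \<in> carrier D" for h w
    proof -
      have hc: "h j \<in> carrier D" "h i \<in> carrier D" and e: "ad (h j) (h i) = k (\<epsilon> j i)"
        using triangular_gensD[OF h] power.prems i by auto
      have "ad (h i) (h j) = k (- \<epsilon> j i)"
        using ad_swap[of "h i" "h j"] hc e by (simp add: k_uminus)
      then have "ad (h i) (h j [^] a) = k (of_nat a) \<otimes> h j [^] (a - 1) \<otimes> k (- \<epsilon> j i)"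
        using ad_pow[of "h i" "h j" a] hc by (simp add: k_central)
      also have "\<dots> = k (of_nat a) \<otimes> (k (- \<epsilon> j i) \<otimes> h j [^] (a - 1))"
        using hc by (metis k_central k_closed m_assoc nat_pow_closed)
      also have "\<dots> = k (- c) \<otimes> h j [^] (a - 1)"
        using k_mult[of "of_nat a" "- \<epsilon> j i"] hc by (simp add: c_def m_assoc)
      finally have "ad (h j [^] a) (h i) = k c \<otimes> h j [^] (a - 1)"
        using ad_swap[of "h j [^] a" "h i"] hc by (simp add: k_uminus l_minus)
      then have "h j [^] a \<otimes> h i = h i \<otimes> h j [^] a \<oplus> k c \<otimes> h j [^] (a - 1)"
        using commute_ad[of "h j [^] a" "h i"] hc by simp
      then show ?thesis using w hc by (simp add: m_assoc r_distr k_left_commute)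
    qed
    show ?thesis
      unfolding eq[OF t(1) u(1)] eq[OF t(2) u(2)]
      by (intro nf.sum nf.power nf_scalar) (use power i g in auto)
  qed
next
  case (sum j p p' q q')
  have g: "g l \<in> carrier D" "g' l \<in> carrier D" if "l < Suc j" for l
    using that t[THEN triangular_gensD(1)] sum.prems by auto
  have "p \<in> carrier D" "q \<in> carrier D" "p' \<in> carrier D" "q' \<in> carrier D"
    using sum(1,2) nf_closed nf_closed[OF nf_swap] g by meson+
  with sum g show ?case by (simp add: l_distr nf.sum)
qed simp

section \<open>Homomorphisms determined by a Weyl system\<close>

definition weyl_system :: "nat \<Rightarrow> (nat \<Rightarrow> 'b) \<Rightarrow> (nat \<Rightarrow> 'b) \<Rightarrow> bool" where
  "weyl_system n x d \<longleftrightarrow> (\<forall>i<n. x i \<in> carrier D \<and> d i \<in> carrier D) \<and>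
     (\<forall>i<n. \<forall>j<n. ad (x i) (x j) = \<zero> \<and> ad (d i) (d j) = \<zero> \<and>
        ad (d i) (x j) = (if i = j then \<one> else \<zero>))"

lemma weyl_systemD:
  assumes "weyl_system n x d" "i < n"
  shows "x i \<in> carrier D" "d i \<in> carrier D"
    "j < n \<Longrightarrow> ad (x i) (x j) = \<zero>" "j < n \<Longrightarrow> ad (d i) (d j) = \<zero>"
    "j < n \<Longrightarrow> ad (d i) (x j) = (if i = j then \<one> else \<zero>)"
    "j < n \<Longrightarrow> ad (x i) (d j) = (if i = j then \<ominus> \<one> else \<zero>)"
proof -
  show c: "x i \<in> carrier D" "d i \<in> carrier D"
    "j < n \<Longrightarrow> ad (x i) (x j) = \<zero>" "j < n \<Longrightarrow> ad (d i) (d j) = \<zero>"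
    "j < n \<Longrightarrow> ad (d i) (x j) = (if i = j then \<one> else \<zero>)"
    using assms by (simp_all add: weyl_system_def)
  show "ad (x i) (d j) = (if i = j then \<ominus> \<one> else \<zero>)" if "j < n"
    using ad_swap[of "x i" "d j"] assms that by (simp add: weyl_system_def)
qed

inductive_set gen_alg :: "nat \<Rightarrow> (nat \<Rightarrow> 'b) \<Rightarrow> (nat \<Rightarrow> 'b) \<Rightarrow> 'b set" for n x d where
  scalar: "k c \<in> gen_alg n x d"
| gen_x: "i < n \<Longrightarrow> x i \<in> gen_alg n x d"
| gen_d: "i < n \<Longrightarrow> d i \<in> gen_alg n x d"
| add: "p \<in> gen_alg n x d \<Longrightarrow> q \<in> gen_alg n x d \<Longrightarrow> p \<oplus> q \<in> gen_alg n x d"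
| mult: "p \<in> gen_alg n x d \<Longrightarrow> q \<in> gen_alg n x d \<Longrightarrow> p \<otimes> q \<in> gen_alg n x d"

text \<open>The subalgebra generated by the pairs of corresponding generators, that is, the graph of
  the homomorphism still to be constructed. Being a relation, it needs no choice of an expression
  for an element.\<close>

inductive gen_pair ::
    "nat \<Rightarrow> (nat \<Rightarrow> 'b) \<Rightarrow> (nat \<Rightarrow> 'b) \<Rightarrow> (nat \<Rightarrow> 'b) \<Rightarrow> (nat \<Rightarrow> 'b) \<Rightarrow> 'b \<Rightarrow> 'b \<Rightarrow> bool"
  for n x d y b where
  scalar: "gen_pair n x d y b (k c) (k c)"
| gen_x: "i < n \<Longrightarrow> gen_pair n x d y b (x i) (y i)"
| gen_d: "i < n \<Longrightarrow> gen_pair n x d y b (d i) (b i)"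
| add: "gen_pair n x d y b p p' \<Longrightarrow> gen_pair n x d y b q q' \<Longrightarrow> gen_pair n x d y b (p \<oplus> q) (p' \<oplus> q')"
| mult: "gen_pair n x d y b p p' \<Longrightarrow> gen_pair n x d y b q q' \<Longrightarrow> gen_pair n x d y b (p \<otimes> q) (p' \<otimes> q')"

lemma gen_alg_closed: "weyl_system n x d \<Longrightarrow> p \<in> gen_alg n x d \<Longrightarrow> p \<in> carrier D"
  by (erule gen_alg.induct) (auto simp: weyl_systemD)

lemma gen_pair_exists: "p \<in> gen_alg n x d \<Longrightarrow> \<exists>p'. gen_pair n x d y b p p'"
  by (induction rule: gen_alg.induct) (blast intro: gen_pair.intros)+

lemma gen_pair_left: "gen_pair n x d y b p p' \<Longrightarrow> p \<in> gen_alg n x d"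
  by (induction rule: gen_pair.induct) (blast intro: gen_alg.intros)+

lemma gen_pair_swap: "gen_pair n x d y b p p' \<Longrightarrow> gen_pair n y b x d p' p"
  by (induction rule: gen_pair.induct) (blast intro: gen_pair.intros)+

definition gens :: "nat \<Rightarrow> (nat \<Rightarrow> 'b) \<Rightarrow> (nat \<Rightarrow> 'b) \<Rightarrow> nat \<Rightarrow> 'b" where
  "gens n x d i = (if i < n then x i else d (i - n))"

text \<open>The \<open>x\<close> precede the \<open>d\<close>, and \<open>d l\<close> has index
  \<open>l + n\<close>, which gives the structure constants. The derivative in \<open>x i\<close> is
  the commutator with \<open>d i\<close>; the derivative in \<open>d i\<close> is the commutator
  with \<open>\<ominus> x i\<close>, because [-x_i, d_i] = 1.\<close>

lemma weyl_triangular: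
  assumes "weyl_system n x d"
  shows "triangular_gens (2 * n) (gens n x d) (\<lambda>i l. if l + n = i then 1 else 0)"
proof -
  note w = weyl_systemD[OF assms]
  have "\<exists>z\<in>carrier D. ad z (gens n x d i) = \<one> \<and> (\<forall>l<i. ad z (gens n x d l) = \<zero>)"
    if "i < 2 * n" for i
  proof (cases "i < n")
    case True
    then show ?thesis
      by (intro bexI[of _ "d i"]) (auto simp: gens_def w)
  next
    case False
    then have i: "i - n < n" using that by auto
    show ?thesis
      using False i that
      by (intro bexI[of _ "\<ominus> x (i - n)"])
        (auto simp: gens_def w ad_uminus_left)
  qed
  then show ?thesis
    unfolding triangular_gens_def by (auto simp: gens_def w)
qed

context
  fixes n x d y b
  assumes wx: "weyl_system n x d" and wy: "weyl_system n y b"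
begin

text \<open>Normal forms are stable under right multiplication by the graph. Applied to the normal
  form of \<one>, this brings both entries of every pair to normal order simultaneously.\<close>

lemma nf_mult_gen_pair:
  assumes "gen_pair n x d y b p p'"
  shows "nf (gens n x d) (gens n y b) (2 * n) q q' \<Longrightarrow>
    nf (gens n x d) (gens n y b) (2 * n) (q \<otimes> p) (q' \<otimes> p')"
  using assms
proof (induction arbitrary: q q' rule: gen_pair.induct)
  case (scalar c)
  have g: "gens n x d i \<in> carrier D" "gens n y b i \<in> carrier D" if "i < 2 * n" for i
    using that wx wy weyl_triangular triangular_gensD(1) by blast+
  show ?case
    using scalar nf_scalar[OF scalar, of c] g nf_closed[OF scalar] nf_closed[OF nf_swap[OF scalar]]
    by (simp add: k_central)
next
  case (gen_x i)
  then show ?case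
    using nf_mult_gen[OF weyl_triangular[OF wx] weyl_triangular[OF wy] gen_x(2), of i]
    by (simp add: gens_def)
next
  case (gen_d i)
  then show ?case
    using nf_mult_gen[OF weyl_triangular[OF wx] weyl_triangular[OF wy] gen_d(2), of "i + n"]
    by (simp add: gens_def)
next
  case (add p p' r r')
  have g: "gens n x d i \<in> carrier D" "gens n y b i \<in> carrier D" if "i < 2 * n" for i
    using that wx wy weyl_triangular triangular_gensD(1) by blast+
  have c: "p \<in> carrier D" "r \<in> carrier D" "p' \<in> carrier D" "r' \<in> carrier D"
    "q \<in> carrier D" "q' \<in> carrier D"
    using add gen_pair_left gen_pair_left[OF gen_pair_swap] gen_alg_closed wx wy
      nf_closed[OF add(5)] nf_closed[OF nf_swap[OF add(5)]] g by auto
  show ?case using nf_sum[OF add(3,4)[OF add(5)]] c by (simp add: r_distr)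
next
  case (mult p p' r r')
  have g: "gens n x d i \<in> carrier D" "gens n y b i \<in> carrier D" if "i < 2 * n" for i
    using that wx wy weyl_triangular triangular_gensD(1) by blast+
  have c: "p \<in> carrier D" "r \<in> carrier D" "p' \<in> carrier D" "r' \<in> carrier D"
    "q \<in> carrier D" "q' \<in> carrier D"
    using mult gen_pair_left gen_pair_left[OF gen_pair_swap] gen_alg_closed wx wy
      nf_closed[OF mult(5)] nf_closed[OF nf_swap[OF mult(5)]] g by auto
  show ?case using mult(4)[OF mult(3)[OF mult(5)]] c by (simp add: m_assoc)
qed

lemma gen_pair_closed:
  assumes "gen_pair n x d y b p p'"
  shows "p \<in> carrier D" "p' \<in> carrier D"
  using assms gen_pair_left gen_pair_left[OF gen_pair_swap] gen_alg_closed wx wy by auto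

text \<open>Multiplying the normal form of \<one> by the pair yields a normal form to which
  \<open>nf_zero\<close> applies. Since the graph is closed under differences, this case already
  makes it functional.\<close>

lemma gen_pair_zero:
  assumes "gen_pair n x d y b \<zero> p'"
  shows "p' = \<zero>"
proof -
  have g: "gens n x d i \<in> carrier D" "gens n y b i \<in> carrier D" if "i < 2 * n" for i
    using that wx wy weyl_triangular triangular_gensD(1) by blast+
  have "nf (gens n x d) (gens n y b) (2 * n) \<one> \<one>"
    using nf_k[of "2 * n" "gens n x d" "gens n y b" 1] g by simp
  then have "nf (gens n x d) (gens n y b) (2 * n) (\<one> \<otimes> \<zero>) (\<one> \<otimes> p')"
    using nf_mult_gen_pair[OF assms] by blast
  then show ?thesis
    using nf_zero[OF weyl_triangular[OF wx], of "gens n y b" "2 * n"] g gen_pair_closed[OF assms]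
    by auto
qed

lemma gen_pair_functional:
  assumes "gen_pair n x d y b p p'" "gen_pair n x d y b p q'"
  shows "p' = q'"
proof -
  note c = gen_pair_closed[OF assms(1)] gen_pair_closed[OF assms(2)]
  have "gen_pair n x d y b (p \<oplus> k (- 1) \<otimes> p) (p' \<oplus> k (- 1) \<otimes> q')"
    using assms by (intro gen_pair.intros)
  then have "gen_pair n x d y b \<zero> (p' \<ominus> q')"
    using c by (simp add: k_uminus l_minus r_neg minus_eq)
  from gen_pair_zero[OF this] show ?thesis using c by (simp add: diff_eq_zero_iff)
qed

end

text \<open>Since \<^term>\<open>D\<close> is assumed to consist of right fractions, the right Ore condition for the
  subalgebra comes for free.\<close>

definition fractions :: "nat \<Rightarrow> (nat \<Rightarrow> 'b) \<Rightarrow> (nat \<Rightarrow> 'b) \<Rightarrow> bool" where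
  "fractions n x d \<longleftrightarrow> (\<forall>z\<in>carrier D. \<exists>q\<in>gen_alg n x d. q \<noteq> \<zero> \<and> z \<otimes> q \<in> gen_alg n x d)"

text \<open>The element \<open>inv q \<otimes> r\<close> of \<open>D\<close> is itself a right
  fraction; \<open>v\<close> is its denominator.\<close>

lemma ore:
  assumes "weyl_system n x d" "fractions n x d" "q \<in> gen_alg n x d" "q \<noteq> \<zero>" "r \<in> gen_alg n x d"
  shows "\<exists>u\<in>gen_alg n x d. \<exists>v\<in>gen_alg n x d. v \<noteq> \<zero> \<and> q \<otimes> u = r \<otimes> v"
proof -
  have c: "q \<in> carrier D" "r \<in> carrier D" and u: "q \<in> Units D"
    using assms gen_alg_closed units by blast+
  obtain v where v: "v \<in> gen_alg n x d" "v \<noteq> \<zero>" "inv q \<otimes> r \<otimes> v \<in> gen_alg n x d"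
    using assms(2) c u unfolding fractions_def by (meson Units_inv_closed m_closed)
  have "v \<in> carrier D" using assms(1) v gen_alg_closed by blast
  then have "q \<otimes> (inv q \<otimes> r \<otimes> v) = r \<otimes> v"
    using c u by (simp add: m_assoc[symmetric])
  with v show ?thesis by blast
qed

section \<open>Extension of the homomorphism from the algebra to its fractions\<close>

context
  fixes n x d y b
  assumes wx: "weyl_system n x d" and wy: "weyl_system n y b" and fr: "fractions n x d"
begin

text \<open>If \<open>z\<close> is the fraction of \<open>p\<close> and \<open>q\<close>, then
  \<open>w\<close> is the fraction of their counterparts. Multiplying by denominators avoids
  inverses in the definition and any choice of a representing fraction.\<close>

definition frac_pair :: "'b \<Rightarrow> 'b \<Rightarrow> bool" where
  "frac_pair z w \<longleftrightarrow> z \<in> carrier D \<and> w \<in> carrier D \<and>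
     (\<exists>q q'. gen_pair n x d y b q q' \<and> q \<noteq> \<zero> \<and> gen_pair n x d y b (z \<otimes> q) (w \<otimes> q'))"

text \<open>The graph is symmetric in the two Weyl systems, so \<open>gen_pair_zero\<close> also
  holds in the opposite direction. Images of denominators can therefore be inverted.\<close>

lemma gen_pair_nonzero:
  assumes "gen_pair n x d y b p p'" "p \<noteq> \<zero>"
  shows "p' \<noteq> \<zero>"
  using assms gen_pair_zero[OF wy wx] gen_pair_swap by blast

lemma frac_pairI: "gen_pair n x d y b p p' \<Longrightarrow> frac_pair p p'"
  unfolding frac_pair_def using gen_pair_closed[OF wx wy] gen_pair.scalar[of n x d y b 1] nontrivial
  by fastforce

lemma ore_pair:
  assumes "gen_pair n x d y b q q'" "q \<noteq> \<zero>" "gen_pair n x d y b r r'"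
  shows "\<exists>u u' v v'. gen_pair n x d y b u u' \<and> gen_pair n x d y b v v' \<and> v \<noteq> \<zero> \<and>
    q \<otimes> u = r \<otimes> v \<and> q' \<otimes> u' = r' \<otimes> v'"
proof -
  obtain u v where uv: "u \<in> gen_alg n x d" "v \<in> gen_alg n x d" "v \<noteq> \<zero>" "q \<otimes> u = r \<otimes> v"
    using ore[OF wx fr] assms gen_pair_left by meson
  obtain u' v' where p: "gen_pair n x d y b u u'" "gen_pair n x d y b v v'"
    using uv gen_pair_exists by meson
  have "q' \<otimes> u' = r' \<otimes> v'"
    using gen_pair_functional[OF wx wy] gen_pair.mult[OF assms(1) p(1)]
      gen_pair.mult[OF assms(3) p(2)] uv by metis
  with p uv show ?thesis by blast
qed

text \<open>The Ore condition provides the common denominator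
  \<open>q \<otimes> u = r \<otimes> v\<close>, and the counterparts of \<open>u\<close> and
  \<open>v\<close> provide one on the other side.\<close>

lemma frac_pair_add:
  assumes "frac_pair z w" "frac_pair z' w'"
  shows "frac_pair (z \<oplus> z') (w \<oplus> w')"
proof -
  have c: "z \<in> carrier D" "w \<in> carrier D" "z' \<in> carrier D" "w' \<in> carrier D"
    using assms unfolding frac_pair_def by auto
  obtain q q' r r' where q: "gen_pair n x d y b q q'" "q \<noteq> \<zero>" "gen_pair n x d y b (z \<otimes> q) (w \<otimes> q')"
    and r: "gen_pair n x d y b r r'" "r \<noteq> \<zero>" "gen_pair n x d y b (z' \<otimes> r) (w' \<otimes> r')"
    using assms unfolding frac_pair_def by blast
  obtain u u' v v' where uv: "gen_pair n x d y b u u'" "gen_pair n x d y b v v'" "v \<noteq> \<zero>"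
    "q \<otimes> u = r \<otimes> v" "q' \<otimes> u' = r' \<otimes> v'"
    using ore_pair[OF q(1,2) r(1)] by blast
  note cl = gen_pair_closed[OF wx wy]
  note c' = cl[OF q(1)] cl[OF r(1)] cl[OF uv(1)] cl[OF uv(2)]
  have "gen_pair n x d y b (z \<otimes> q \<otimes> u \<oplus> z' \<otimes> r \<otimes> v) (w \<otimes> q' \<otimes> u' \<oplus> w' \<otimes> r' \<otimes> v')"
    by (rule gen_pair.add[OF gen_pair.mult[OF q(3) uv(1)] gen_pair.mult[OF r(3) uv(2)]])
  moreover have "z \<otimes> q \<otimes> u \<oplus> z' \<otimes> r \<otimes> v = (z \<oplus> z') \<otimes> (r \<otimes> v)"
    "w \<otimes> q' \<otimes> u' \<oplus> w' \<otimes> r' \<otimes> v' = (w \<oplus> w') \<otimes> (r' \<otimes> v')"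
    using c c' uv(4,5) by (simp_all add: m_assoc l_distr)
  moreover have "gen_pair n x d y b (r \<otimes> v) (r' \<otimes> v')" "r \<otimes> v \<noteq> \<zero>"
    using r uv c' by (auto intro: gen_pair.mult simp: mult_eq_zero_iff)
  ultimately show ?thesis unfolding frac_pair_def using c by (metis a_closed)
qed

text \<open>Here the Ore condition is applied to the denominator \<open>q\<close> of the left factor
  and the numerator \<open>z' \<otimes> r\<close> of the right one, so that
  \<open>r \<otimes> v\<close> is a denominator of the product.\<close>

lemma frac_pair_mult:
  assumes "frac_pair z w" "frac_pair z' w'"
  shows "frac_pair (z \<otimes> z') (w \<otimes> w')"
proof -
  have c: "z \<in> carrier D" "w \<in> carrier D" "z' \<in> carrier D" "w' \<in> carrier D"
    using assms unfolding frac_pair_def by auto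
  obtain q q' r r' where q: "gen_pair n x d y b q q'" "q \<noteq> \<zero>" "gen_pair n x d y b (z \<otimes> q) (w \<otimes> q')"
    and r: "gen_pair n x d y b r r'" "r \<noteq> \<zero>" "gen_pair n x d y b (z' \<otimes> r) (w' \<otimes> r')"
    using assms unfolding frac_pair_def by blast
  obtain u u' v v' where uv: "gen_pair n x d y b u u'" "gen_pair n x d y b v v'" "v \<noteq> \<zero>"
    "q \<otimes> u = z' \<otimes> r \<otimes> v" "q' \<otimes> u' = w' \<otimes> r' \<otimes> v'"
    using ore_pair[OF q(1,2) r(3)] by blast
  note cl = gen_pair_closed[OF wx wy]
  note c' = cl[OF q(1)] cl[OF r(1)] cl[OF uv(1)] cl[OF uv(2)]
  have "gen_pair n x d y b (z \<otimes> q \<otimes> u) (w \<otimes> q' \<otimes> u')"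
    by (rule gen_pair.mult[OF q(3) uv(1)])
  moreover have "z \<otimes> q \<otimes> u = (z \<otimes> z') \<otimes> (r \<otimes> v)" "w \<otimes> q' \<otimes> u' = (w \<otimes> w') \<otimes> (r' \<otimes> v')"
    using c c' uv(4,5) by (simp_all add: m_assoc)
  moreover have "gen_pair n x d y b (r \<otimes> v) (r' \<otimes> v')" "r \<otimes> v \<noteq> \<zero>"
    using r uv c' by (auto intro: gen_pair.mult simp: mult_eq_zero_iff)
  ultimately show ?thesis unfolding frac_pair_def using c by (metis m_closed)
qed

lemma frac_pair_zero:
  assumes "frac_pair \<zero> w"
  shows "w = \<zero>"
proof -
  obtain q q' where q: "gen_pair n x d y b q q'" "q \<noteq> \<zero>" "gen_pair n x d y b (\<zero> \<otimes> q) (w \<otimes> q')"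
    and w: "w \<in> carrier D"
    using assms unfolding frac_pair_def by blast
  note c = gen_pair_closed[OF wx wy q(1)]
  have "w \<otimes> q' = \<zero>" using gen_pair_zero[OF wx wy] q(3) c by simp
  then show ?thesis using gen_pair_nonzero[OF q(1,2)] c w by (simp add: mult_eq_zero_iff)
qed

lemma frac_pair_ex1:
  assumes "z \<in> carrier D"
  shows "\<exists>!w. frac_pair z w"
proof -
  obtain q where q: "q \<in> gen_alg n x d" "q \<noteq> \<zero>" "z \<otimes> q \<in> gen_alg n x d"
    using fr assms unfolding fractions_def by blast
  obtain q' p' where g: "gen_pair n x d y b q q'" "gen_pair n x d y b (z \<otimes> q) p'"
    using q gen_pair_exists by meson
  note c = gen_pair_closed[OF wx wy g(1)] gen_pair_closed[OF wx wy g(2)]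
  have u: "q' \<in> Units D" using gen_pair_nonzero[OF g(1) q(2)] c units by blast
  then have "frac_pair z (p' \<otimes> inv q')"
    unfolding frac_pair_def using g q assms c
    by (intro conjI exI[of _ q] exI[of _ q']) (simp_all add: m_assoc)
  moreover have "w = w'" if "frac_pair z w" "frac_pair z w'" for w w'
  proof -
    \<comment> \<open>Two values for the same \<open>z\<close> differ by a value for \<zero>, and
      this can only be \<zero>.\<close>
    have "frac_pair (z \<oplus> k (- 1) \<otimes> z) (w \<oplus> k (- 1) \<otimes> w')"
      by (rule frac_pair_add[OF that(1) frac_pair_mult[OF frac_pairI[OF gen_pair.scalar] that(2)]])
    moreover have "w \<in> carrier D" "w' \<in> carrier D"
      using that unfolding frac_pair_def by auto
    ultimately show ?thesis
      using frac_pair_zero[of "w \<oplus> \<ominus> w'"] assms diff_eq_zero_iff[of w w']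
      by (simp add: k_uminus l_minus r_neg minus_eq)
  qed
  ultimately show ?thesis by blast
qed

text \<open>Used for two kinds of target: the dual system \<open>y\<close>, \<open>b\<close>, and
  the permuted generators.\<close>

lemma weyl_hom_exists:
  "\<exists>h\<in>ring_hom D D. (\<forall>c. h (k c) = k c) \<and> (\<forall>i<n. h (x i) = y i \<and> h (d i) = b i)"
proof -
  define h where "h z = (THE w. frac_pair z w)" for z
  have fp: "frac_pair z (h z)" if "z \<in> carrier D" for z
    unfolding h_def using theI'[OF frac_pair_ex1[OF that]] .
  have eq: "h z = w" if "frac_pair z w" for z w
    using that frac_pair_ex1[of z] fp[of z] unfolding frac_pair_def by blast
  have gp: "h p = p'" if "gen_pair n x d y b p p'" for p p'
    using eq frac_pairI that by blast
  have "h \<in> ring_hom D D"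
  proof (rule ring_hom_memI)
    show "h \<one> = \<one>" using gp[OF gen_pair.scalar[of n x d y b 1]] by simp
    show "h z \<in> carrier D" if "z \<in> carrier D" for z
      using fp[OF that] unfolding frac_pair_def by simp
    show "h (z \<oplus> w) = h z \<oplus> h w" "h (z \<otimes> w) = h z \<otimes> h w"
      if "z \<in> carrier D" "w \<in> carrier D" for z w
      by (rule eq, rule frac_pair_add[OF fp[OF that(1)] fp[OF that(2)]])
        (rule eq, rule frac_pair_mult[OF fp[OF that(1)] fp[OF that(2)]])
  qed
  moreover have "h (k c) = k c" for c by (rule gp[OF gen_pair.scalar])
  moreover have "h (x i) = y i \<and> h (d i) = b i" if "i < n" for i
    using gp[OF gen_pair.gen_x[OF that]] gp[OF gen_pair.gen_d[OF that]] by simp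
  ultimately show ?thesis by blast
qed

end

lemma ring_hom_sub_zero:
  assumes "h \<in> ring_hom D D"
  shows "h \<zero> = \<zero>"
  by (rule ring_hom_zero[OF assms ring_axioms ring_axioms])

lemma ring_hom_nonzero:
  assumes "h \<in> ring_hom D D" "z \<in> carrier D" "z \<noteq> \<zero>"
  shows "h z \<noteq> \<zero>"
proof
  assume "h z = \<zero>"
  have u: "z \<in> Units D" using assms units by blast
  have "h (z \<otimes> inv z) = h z \<otimes> h (inv z)" 
    using ring_hom_mult[OF assms(1) assms(2) Units_inv_closed[OF u]] .
  then show False
    using \<open>h z = \<zero>\<close> u nontrivial ring_hom_one[OF assms(1)] ring_hom_closed[OF assms(1)] by simp
qed

text \<open>Agreement on the algebra covers both \<open>q\<close> and \<open>z \<otimes> q\<close>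
  for a denominator \<open>q\<close> of \<open>z\<close>, and \<open>h q\<close> can be cancelled
  because it is nonzero.\<close>

lemma weyl_hom_unique:
  assumes "weyl_system n x d" "fractions n x d" "h \<in> ring_hom D D" "h' \<in> ring_hom D D"
    and "\<And>c. h (k c) = h' (k c)" "\<And>i. i < n \<Longrightarrow> h (x i) = h' (x i)" "\<And>i. i < n \<Longrightarrow> h (d i) = h' (d i)"
    and "z \<in> carrier D"
  shows "h z = h' z"
proof -
  have alg: "h p = h' p" if "p \<in> gen_alg n x d" for p
    using that
  proof (induction rule: gen_alg.induct)
    case (add p q)
    then show ?case
      using gen_alg_closed[OF assms(1)] ring_hom_add[OF assms(3)] ring_hom_add[OF assms(4)] by simp
  next
    case (mult p q)
    then show ?case
      using gen_alg_closed[OF assms(1)] ring_hom_mult[OF assms(3)] ring_hom_mult[OF assms(4)] by simp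
  qed (use assms in auto)
  obtain q where q: "q \<in> gen_alg n x d" "q \<noteq> \<zero>" "z \<otimes> q \<in> gen_alg n x d"
    using assms unfolding fractions_def by blast
  have c: "q \<in> carrier D" using q gen_alg_closed assms by blast
  have "h z \<otimes> h q = h' z \<otimes> h q"
    using alg[OF q(1)] alg[OF q(3)] ring_hom_mult[OF assms(3) assms(8) c]
      ring_hom_mult[OF assms(4) assms(8) c] by simp
  then show ?thesis
    using right_cancel[of "h z" "h' z" "h q"] ring_hom_nonzero[OF assms(3) c q(2)]
      ring_hom_closed[OF assms(3)] ring_hom_closed[OF assms(4)] assms(8) c by simp
qed

section \<open>Vandermonde systems with commuting nodes\<close>

lemma pow_commutes:
  assumes "z \<in> carrier D" "p \<in> carrier D" "z \<otimes> p = p \<otimes> z"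
  shows "z \<otimes> p [^] (m::nat) = p [^] m \<otimes> z"
proof -
  have "ad z p = \<zero>" using assms by (simp add: ad_eq_zero_iff)
  then have "ad z (p [^] m) = \<zero>" using ad_pow[of z p m] assms by simp
  then show ?thesis using assms by (simp add: ad_eq_zero_iff)
qed

lemma finsum_swap:
  assumes "finite A" "\<And>a b. a \<in> A \<Longrightarrow> b \<in> B \<Longrightarrow> f a b \<in> carrier D"
  shows "(\<Oplus>a\<in>A. \<Oplus>b\<in>B. f a b) = (\<Oplus>b\<in>B. \<Oplus>a\<in>A. f a b)"
  using assms
proof (induction A rule: finite_induct)
  case (insert c A)
  have "(\<Oplus>b\<in>B. \<Oplus>a\<in>insert c A. f a b) = (\<Oplus>b\<in>B. f c b \<oplus> (\<Oplus>a\<in>A. f a b))"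
    using insert by (intro finsum_cong') (auto intro!: finsum_closed)
  also have "\<dots> = (\<Oplus>b\<in>B. f c b) \<oplus> (\<Oplus>b\<in>B. \<Oplus>a\<in>A. f a b)"
    using insert by (intro finsum_addf) (auto intro!: finsum_closed)
  finally show ?case
    using insert by (subst finsum_insert) (auto intro!: finsum_closed)
qed simp

lemma finsum_diff:
  assumes "f \<in> A \<rightarrow> carrier D" "g \<in> A \<rightarrow> carrier D"
  shows "(\<Oplus>a\<in>A. f a \<ominus> g a) = (\<Oplus>a\<in>A. f a) \<ominus> (\<Oplus>a\<in>A. g a)"
proof -
  have g: "(\<Oplus>a\<in>A. \<ominus> g a) = \<ominus> (\<Oplus>a\<in>A. g a)"
    using assms(2)
  proof (induction A rule: infinite_finite_induct)
    case (insert a A)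
    then have "(\<lambda>a. \<ominus> g a) \<in> A \<rightarrow> carrier D" by auto
    then show ?case using insert by (simp add: minus_add)
  qed auto
  have "(\<Oplus>a\<in>A. f a \<ominus> g a) = (\<Oplus>a\<in>A. f a) \<oplus> (\<Oplus>a\<in>A. \<ominus> g a)"
    unfolding minus_eq using assms by (intro finsum_addf) auto
  then show ?thesis by (simp add: g minus_eq)
qed

text \<open>Evaluation of a polynomial with the coefficients on the right: the unknown coefficients
  of the interpolation problem do not commute with the nodes.\<close>

definition peval :: "nat \<Rightarrow> 'b \<Rightarrow> (nat \<Rightarrow> 'b) \<Rightarrow> 'b" where
  "peval n t b = (\<Oplus>i\<in>{..<n}. t [^] i \<otimes> b i)"

lemma peval_closed [simp]:
  "\<lbrakk>t \<in> carrier D; \<And>i. i < n \<Longrightarrow> b i \<in> carrier D\<rbrakk> \<Longrightarrow> peval n t b \<in> carrier D"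
  unfolding peval_def by (intro finsum_closed) auto

lemma peval_0 [simp]: "peval 0 t b = \<zero>"
  by (simp add: peval_def)

lemma peval_Suc:
  assumes "t \<in> carrier D" "\<And>i. i < Suc n \<Longrightarrow> b i \<in> carrier D"
  shows "peval (Suc n) t b = b 0 \<oplus> t \<otimes> peval n t (\<lambda>i. b (Suc i))"
proof (cases n)
  case 0
  then show ?thesis using assms by (simp add: peval_def lessThan_Suc)
next
  case (Suc m)
  have "peval (Suc n) t b = (\<Oplus>i\<in>{..Suc m}. t [^] i \<otimes> b i)"
    unfolding peval_def Suc lessThan_Suc_atMost ..
  also have "\<dots> = (\<Oplus>i\<in>{..m}. t [^] Suc i \<otimes> b (Suc i)) \<oplus> t [^] (0::nat) \<otimes> b 0"
    by (rule add.finprod_Suc2) (use assms Suc in auto)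
  also have "(\<Oplus>i\<in>{..m}. t [^] Suc i \<otimes> b (Suc i)) = (\<Oplus>i\<in>{..m}. t \<otimes> (t [^] i \<otimes> b (Suc i)))"
  proof (rule finsum_cong'[OF refl])
    show "t [^] Suc i \<otimes> b (Suc i) = t \<otimes> (t [^] i \<otimes> b (Suc i))" if "i \<in> {..m}" for i
      using that assms(1) assms(2)[of "Suc i"] Suc
        nat_pow_Suc2[OF assms(1), of i] by (simp add: m_assoc)
  qed (use assms Suc in auto)
  also have "\<dots> = t \<otimes> (\<Oplus>i\<in>{..m}. t [^] i \<otimes> b (Suc i))"
    using assms Suc by (intro finsum_rdistr[symmetric]) auto
  also have "\<dots> = t \<otimes> peval n t (\<lambda>i. b (Suc i))"
    unfolding peval_def Suc lessThan_Suc_atMost ..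
  finally show ?thesis
    using assms by (simp add: a_comm)
qed

lemma peval_1 [simp]: "t \<in> carrier D \<Longrightarrow> b 0 \<in> carrier D \<Longrightarrow> peval (Suc 0) t b = b 0"
  by (simp add: peval_def lessThan_Suc)

text \<open>Horner's scheme, splitting off \<open>t \<ominus> s\<close> on the left. Only
  \<open>t\<close> and \<open>s\<close> have to commute, and \<open>q\<close> and \<open>r\<close>
  do not depend on \<open>t\<close>. The last clause says that quotient and remainder determine the
  polynomial to be zero, which an evaluation at finitely many points could not give
  directly.\<close>

lemma synthetic_division:
  assumes "s \<in> carrier D" "\<forall>i<Suc n. b i \<in> carrier D"
  shows "\<exists>q r. (\<forall>i<n. q i \<in> carrier D) \<and> r \<in> carrier D \<and>
    (\<forall>t\<in>carrier D. t \<otimes> s = s \<otimes> t \<longrightarrow> peval (Suc n) t b = (t \<ominus> s) \<otimes> peval n t q \<oplus> r) \<and>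
    ((\<forall>i<n. q i = \<zero>) \<and> r = \<zero> \<longrightarrow> (\<forall>i<Suc n. b i = \<zero>))"
  using assms(2)
proof (induction n arbitrary: b)
  case 0
  then show ?case using assms(1)
    by (intro exI[of _ b] exI[of _ "b 0"]) (auto simp: peval_Suc)
next
  case (Suc n)
  have "\<forall>i<Suc n. b (Suc i) \<in> carrier D" using Suc.prems by auto
  from Suc.IH[OF this]
  obtain q r where q: "\<forall>i<n. q i \<in> carrier D" and r: "r \<in> carrier D"
    and ev: "\<forall>t\<in>carrier D. t \<otimes> s = s \<otimes> t \<longrightarrow>
        peval (Suc n) t (\<lambda>i. b (Suc i)) = (t \<ominus> s) \<otimes> peval n t q \<oplus> r"
    and z: "(\<forall>i<n. q i = \<zero>) \<and> r = \<zero> \<longrightarrow> (\<forall>i<Suc n. b (Suc i) = \<zero>)"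
    by (elim exE conjE) (rule that)
  note q = q[rule_format] and ev = ev[rule_format]
  \<comment> \<open>If the shifted polynomial is (t - s) q + r, then b_0 + t ((t - s) q + r) = (t -
    s) (r + t q) + (b_0 + s r).\<close>
  define q' where "q' i = (case i of 0 \<Rightarrow> r | Suc i \<Rightarrow> q i)" for i
  have q': "q' i \<in> carrier D" if "i < Suc n" for i
    using that q r by (cases i) (auto simp: q'_def)
  have "peval (Suc (Suc n)) t b = (t \<ominus> s) \<otimes> peval (Suc n) t q' \<oplus> (b 0 \<oplus> s \<otimes> r)"
    if t: "t \<in> carrier D" "t \<otimes> s = s \<otimes> t" for t
  proof -
    define V where "V = peval n t q"
    have c: "V \<in> carrier D" "b 0 \<in> carrier D" using q t Suc.prems by (auto simp: V_def)
    have "peval (Suc n) t q' = r \<oplus> t \<otimes> V"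
      using peval_Suc[of t n q'] q' t by (simp add: q'_def V_def)
    then have "(t \<ominus> s) \<otimes> peval (Suc n) t q' \<oplus> (b 0 \<oplus> s \<otimes> r) =
        ((t \<ominus> s) \<otimes> r \<oplus> s \<otimes> r) \<oplus> (b 0 \<oplus> (t \<ominus> s) \<otimes> (t \<otimes> V))"
      using c t r assms(1) by (simp add: r_distr a_ac)
    also have "(t \<ominus> s) \<otimes> r \<oplus> s \<otimes> r = t \<otimes> r"
      using t r assms(1) by (simp add: minus_eq l_distr l_minus a_assoc l_neg)
    also have "(t \<ominus> s) \<otimes> (t \<otimes> V) = t \<otimes> ((t \<ominus> s) \<otimes> V)"
      using c t assms(1) by (simp add: left_diff_distrib right_diff_distrib m_assoc[symmetric])
    also have "t \<otimes> r \<oplus> (b 0 \<oplus> t \<otimes> ((t \<ominus> s) \<otimes> V)) = b 0 \<oplus> t \<otimes> ((t \<ominus> s) \<otimes> V \<oplus> r)"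
      using c t r assms(1) by (simp add: r_distr a_ac)
    also have "\<dots> = peval (Suc (Suc n)) t b"
      using peval_Suc[of t "Suc n" b] ev[OF t] t Suc.prems by (simp add: V_def)
    finally show ?thesis by simp
  qed
  moreover have "b i = \<zero>" if "\<forall>i<Suc n. q' i = \<zero>" "b 0 \<oplus> s \<otimes> r = \<zero>" "i < Suc (Suc n)" for i
  proof -
    have "r = \<zero>" "\<forall>i<n. q i = \<zero>" using that(1) by (force simp: q'_def)+
    with z that(2,3) assms(1) Suc.prems show ?thesis by (cases i) auto
  qed
  ultimately show ?case
    using q' r assms(1) Suc.prems
    by (intro exI[of _ q'] exI[of _ "b 0 \<oplus> s \<otimes> r"]) auto
qed

text \<open>Converse of \<open>synthetic_division\<close>: uniqueness of interpolation divides by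
  \<open>t \<ominus> s\<close>, existence multiplies by it.\<close>

lemma synthetic_multiplication:
  assumes "s \<in> carrier D" "\<forall>i<n. q i \<in> carrier D" "r \<in> carrier D"
  shows "\<exists>b. (\<forall>i<Suc n. b i \<in> carrier D) \<and>
    (\<forall>t\<in>carrier D. t \<otimes> s = s \<otimes> t \<longrightarrow> peval (Suc n) t b = (t \<ominus> s) \<otimes> peval n t q \<oplus> r)"
  using assms(2,3)
proof (induction n arbitrary: q r)
  case 0
  then show ?case using assms(1)
    by (intro exI[of _ "\<lambda>_. r"]) (auto simp: peval_Suc)
next
  case (Suc n)
  have "\<forall>i<n. q (Suc i) \<in> carrier D" "q 0 \<in> carrier D" using Suc.prems by auto
  from Suc.IH[OF this]
  obtain b where b: "\<forall>i<Suc n. b i \<in> carrier D"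
    and ev: "\<forall>t\<in>carrier D. t \<otimes> s = s \<otimes> t \<longrightarrow>
        peval (Suc n) t b = (t \<ominus> s) \<otimes> peval n t (\<lambda>i. q (Suc i)) \<oplus> q 0"
    by (elim exE conjE) (rule that)
  note b = b[rule_format] and ev = ev[rule_format]
  \<comment> \<open>With q = q_0 + t Q one has (t - s) q + r = (r - s q_0) + t ((t - s) Q + q_0), so
    \<open>q 0\<close> becomes the remainder in the recursive call.\<close>
  define b' where "b' i = (case i of 0 \<Rightarrow> r \<ominus> s \<otimes> q 0 | Suc i \<Rightarrow> b i)" for i
  have q0: "q 0 \<in> carrier D" using Suc.prems by auto
  have b': "b' i \<in> carrier D" if "i < Suc (Suc n)" for i
    using that b q0 Suc.prems(2) assms(1) by (cases i) (auto simp: b'_def)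
  have "peval (Suc (Suc n)) t b' = (t \<ominus> s) \<otimes> peval (Suc n) t q \<oplus> r"
    if t: "t \<in> carrier D" "t \<otimes> s = s \<otimes> t" for t
  proof -
    define V where "V = peval n t (\<lambda>i. q (Suc i))"
    have c: "V \<in> carrier D" using Suc.prems t by (auto simp: V_def)
    note cs = c q0 t(1) assms(1) Suc.prems(2)
    have "peval (Suc (Suc n)) t b' = (r \<ominus> s \<otimes> q 0) \<oplus> t \<otimes> ((t \<ominus> s) \<otimes> V \<oplus> q 0)"
      using peval_Suc[of t "Suc n" b'] b' t ev[OF t] by (simp add: b'_def V_def)
    also have "\<dots> = (t \<otimes> q 0 \<ominus> s \<otimes> q 0) \<oplus> t \<otimes> ((t \<ominus> s) \<otimes> V) \<oplus> r"
      using cs by (simp add: r_distr minus_eq a_ac)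
    also have "t \<otimes> ((t \<ominus> s) \<otimes> V) = (t \<ominus> s) \<otimes> (t \<otimes> V)"
      using cs t(2) by (simp add: left_diff_distrib right_diff_distrib m_assoc[symmetric])
    also have "(t \<otimes> q 0 \<ominus> s \<otimes> q 0) \<oplus> (t \<ominus> s) \<otimes> (t \<otimes> V) = (t \<ominus> s) \<otimes> peval (Suc n) t q"
      using peval_Suc[of t n q] Suc.prems(1) cs by (simp add: r_distr left_diff_distrib V_def)
    finally show ?thesis .
  qed
  then show ?case using b' by (intro exI[of _ b']) auto
qed

definition commuting_distinct :: "'c set \<Rightarrow> ('c \<Rightarrow> 'b) \<Rightarrow> bool" where
  "commuting_distinct S t \<longleftrightarrow> inj_on t S \<and>
     (\<forall>i\<in>S. t i \<in> carrier D \<and> (\<forall>j\<in>S. t i \<otimes> t j = t j \<otimes> t i))"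

text \<open>Determinants are avoided by Newton's interpolation. Dividing by t - x_n, the value at
  x_n shows that the remainder is zero; at the other nodes the nonzero factor x_j - x_n cancels, and
  the quotient vanishes there.\<close>

lemma vandermonde_zero:
  assumes "commuting_distinct {..<n} x" "\<And>i. i < n \<Longrightarrow> b i \<in> carrier D"
    and "\<And>j. j < n \<Longrightarrow> peval n (x j) b = \<zero>" "i < n"
  shows "b i = \<zero>"
  using assms
proof (induction n arbitrary: b i)
  case (Suc n)
  have x: "x j \<in> carrier D" and xn: "x j \<otimes> x n = x n \<otimes> x j" if "j \<le> n" for j
    using Suc.prems(1) that by (auto simp: commuting_distinct_def)
  have "\<forall>i<Suc n. b i \<in> carrier D" using Suc.prems(2) by blast
  from synthetic_division[OF x[OF order_refl] this]
  obtain q r where q: "\<forall>i<n. q i \<in> carrier D" and r: "r \<in> carrier D"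
    and ev: "\<forall>t\<in>carrier D. t \<otimes> x n = x n \<otimes> t \<longrightarrow>
        peval (Suc n) t b = (t \<ominus> x n) \<otimes> peval n t q \<oplus> r"
    and z: "(\<forall>i<n. q i = \<zero>) \<and> r = \<zero> \<longrightarrow> (\<forall>i<Suc n. b i = \<zero>)"
    by (elim exE conjE) (rule that)
  note q = q[rule_format] and ev = ev[rule_format]
  have r0: "r = \<zero>"
    using ev[OF x xn] Suc.prems(3)[of n] x[of n] q r by simp
  have "q i = \<zero>" if "i < n" for i
  proof (rule Suc.IH[OF _ q _ that])
    show "commuting_distinct {..<n} x"
      using Suc.prems(1) by (auto simp: commuting_distinct_def inj_on_def)
    show "peval n (x j) q = \<zero>" if "j < n" for j
    proof -
      have "x j \<noteq> x n"
        using Suc.prems(1) that by (auto simp: commuting_distinct_def inj_on_def)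
      then have "x j \<ominus> x n \<noteq> \<zero>" using x that by (simp add: diff_eq_zero_iff)
      moreover have "(x j \<ominus> x n) \<otimes> peval n (x j) q = \<zero>"
        using ev[OF x xn, of j] Suc.prems(3)[of j] r0 x[of j] x[of n] q that by simp
      ultimately show ?thesis using x q that by (simp add: mult_eq_zero_iff)
    qed
  qed
  with z r0 Suc.prems(4) show ?case by blast
qed simp

lemma vandermonde_unique:
  assumes "commuting_distinct {..<n} x"
    and "\<And>i. i < n \<Longrightarrow> b i \<in> carrier D" "\<And>i. i < n \<Longrightarrow> b' i \<in> carrier D"
    and "\<And>j. j < n \<Longrightarrow> peval n (x j) b = peval n (x j) b'" "i < n"
  shows "b i = b' i"
proof -
  have "b i \<ominus> b' i = \<zero>"
  proof (rule vandermonde_zero[OF assms(1) _ _ assms(5)])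
    fix j assume j: "j < n"
    then have x: "x j \<in> carrier D" using assms(1) by (auto simp: commuting_distinct_def)
    have "peval n (x j) (\<lambda>i. b i \<ominus> b' i) = (\<Oplus>i\<in>{..<n}. x j [^] i \<otimes> b i \<ominus> x j [^] i \<otimes> b' i)"
      unfolding peval_def using assms(2,3) x
      by (intro finsum_cong') (auto simp: right_diff_distrib)
    also have "\<dots> = peval n (x j) b \<ominus> peval n (x j) b'"
      unfolding peval_def using assms(2,3) x by (intro finsum_diff) auto
    finally show "peval n (x j) (\<lambda>i. b i \<ominus> b' i) = \<zero>"
      using assms(2-4) x j by simp
  qed (use assms in auto)
  then show ?thesis using assms by (simp add: diff_eq_zero_iff)
qed

text \<open>Newton's scheme in the other direction: the remainder is the value at the last node, and
  the quotient interpolates the divided differences at the remaining ones.\<close>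

lemma vandermonde_exists:
  assumes "commuting_distinct {..<n} x" "\<And>j. j < n \<Longrightarrow> v j \<in> carrier D"
  shows "\<exists>b. (\<forall>i<n. b i \<in> carrier D) \<and> (\<forall>j<n. peval n (x j) b = v j)"
  using assms
proof (induction n arbitrary: v)
  case (Suc n)
  have x: "x j \<in> carrier D" and xn: "x j \<otimes> x n = x n \<otimes> x j" if "j \<le> n" for j
    using Suc.prems(1) that by (auto simp: commuting_distinct_def)
  have u: "x j \<ominus> x n \<in> Units D" if "j < n" for j
  proof -
    have "x j \<noteq> x n"
      using Suc.prems(1) that by (auto simp: commuting_distinct_def inj_on_def)
    then show ?thesis using units[of "x j \<ominus> x n"] x that by (simp add: diff_eq_zero_iff)
  qed
  have cd: "commuting_distinct {..<n} x"
    using Suc.prems(1) by (auto simp: commuting_distinct_def inj_on_def)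
  have "inv (x j \<ominus> x n) \<otimes> (v j \<ominus> v n) \<in> carrier D" if "j < n" for j
    using u that Suc.prems(2) by auto
  with Suc.IH[OF cd, of "\<lambda>j. inv (x j \<ominus> x n) \<otimes> (v j \<ominus> v n)"]
  obtain q where q: "\<And>i. i < n \<Longrightarrow> q i \<in> carrier D"
    "\<And>j. j < n \<Longrightarrow> peval n (x j) q = inv (x j \<ominus> x n) \<otimes> (v j \<ominus> v n)" by auto
  have "\<forall>i<n. q i \<in> carrier D" using q(1) by blast
  from synthetic_multiplication[OF x[OF order_refl] this Suc.prems(2)[OF lessI]]
  obtain b where b: "\<forall>i<Suc n. b i \<in> carrier D"
    and ev: "\<forall>t\<in>carrier D. t \<otimes> x n = x n \<otimes> t \<longrightarrow>
        peval (Suc n) t b = (t \<ominus> x n) \<otimes> peval n t q \<oplus> v n"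
    by (elim exE conjE) (rule that)
  note b = b[rule_format] and ev = ev[rule_format]
  have "peval (Suc n) (x j) b = v j" if "j < Suc n" for j
  proof (cases "j = n")
    case True
    then show ?thesis using ev[OF x xn, of n] x[of n] q Suc.prems(2) by simp
  next
    case False
    then have j: "j < n" using that by simp
    have c: "v j \<in> carrier D" "v n \<in> carrier D" using Suc.prems(2) that by auto
    have "peval (Suc n) (x j) b = (v j \<ominus> v n) \<oplus> v n"
      using ev[OF x xn, of j] x[of j] x[of n] q(2)[OF j] u[OF j] j c
      by (simp add: m_assoc[symmetric])
    then show ?thesis using c by (simp add: minus_eq a_assoc l_neg)
  qed
  then show ?case using b by blast
qed simp

text \<open>The transposed Vandermonde system, with weights on the left. Subtracting the identity
  for \<open>m\<close> times \<open>t a\<close> from the identity for \<open>Suc m\<close> removes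
  the node \<open>a\<close> and turns each weight \<open>w s\<close> into
  \<open>w s \<otimes> (t s \<ominus> t a)\<close>, to which the induction hypothesis
  applies.\<close>

lemma power_sums_weights_zero:
  assumes "finite S" "commuting_distinct S t" "\<And>s. s \<in> S \<Longrightarrow> w s \<in> carrier D"
    and "\<And>m::nat. (\<Oplus>s\<in>S. w s \<otimes> t s [^] m) = \<zero>" "s \<in> S"
  shows "w s = \<zero>"
  using assms
proof (induction S arbitrary: w s rule: finite_induct)
  case (insert a S)
  have t: "t s \<in> carrier D" and ta: "t s \<otimes> t a = t a \<otimes> t s" if "s \<in> insert a S" for s
    using insert.prems(1) that by (auto simp: commuting_distinct_def)
  have w: "w s \<in> carrier D" if "s \<in> insert a S" for s using insert.prems(2) that .
  have split: "w a \<otimes> t a [^] m \<oplus> (\<Oplus>s\<in>S. w s \<otimes> t s [^] m) = \<zero>" for m :: nat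
    using insert.prems(3)[of m] insert.hyps t w by (subst (asm) finsum_insert) auto
  have Sc: "(\<Oplus>s\<in>S. w s \<otimes> t s [^] m) \<in> carrier D" for m :: nat
    using t w by (intro finsum_closed) auto
  have S: "(\<Oplus>s\<in>S. w s \<otimes> t s [^] m) = \<ominus> (w a \<otimes> t a [^] m)" for m :: nat
    using split[of m] Sc[of m] t[of a] w[of a] by (metis insertI1 m_closed minus_equality nat_pow_closed a_comm minus_minus)
  have w': "w s \<otimes> (t s \<ominus> t a) = \<zero>" if "s \<in> S" for s
  proof (rule insert.IH[OF _ _ _ that])
    show "commuting_distinct S t"
      using insert.prems(1) by (auto simp: commuting_distinct_def inj_on_def)
    show "w s \<otimes> (t s \<ominus> t a) \<in> carrier D" if "s \<in> S" for s
      using t w that by auto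
    fix m :: nat
    have "(w s \<otimes> (t s \<ominus> t a)) \<otimes> t s [^] m = w s \<otimes> t s [^] Suc m \<ominus> (w s \<otimes> t s [^] m) \<otimes> t a"
      if "s \<in> S" for s
    proof -
      have ts: "t s \<in> carrier D" "t a \<in> carrier D" "w s \<in> carrier D" using t w that by auto
      have "t a \<otimes> t s [^] m = t s [^] m \<otimes> t a"
        using pow_commutes[of "t a" "t s" m] ta[of s] ts that by simp
      then show ?thesis using ts by (simp add: right_diff_distrib left_diff_distrib m_assoc nat_pow_Suc2[symmetric])
    qed
    then have "(\<Oplus>s\<in>S. (w s \<otimes> (t s \<ominus> t a)) \<otimes> t s [^] m) =
        (\<Oplus>s\<in>S. w s \<otimes> t s [^] Suc m \<ominus> (w s \<otimes> t s [^] m) \<otimes> t a)"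
      using t w by (intro finsum_cong') auto
    also have "\<dots> = (\<Oplus>s\<in>S. w s \<otimes> t s [^] Suc m) \<ominus> (\<Oplus>s\<in>S. (w s \<otimes> t s [^] m) \<otimes> t a)"
      using t w by (intro finsum_diff) auto
    also have "(\<Oplus>s\<in>S. (w s \<otimes> t s [^] m) \<otimes> t a) = (\<Oplus>s\<in>S. w s \<otimes> t s [^] m) \<otimes> t a"
      using t w insert.hyps by (intro finsum_ldistr[symmetric]) auto
    also have "(\<Oplus>s\<in>S. w s \<otimes> t s [^] Suc m) \<ominus> (\<Oplus>s\<in>S. w s \<otimes> t s [^] m) \<otimes> t a = \<zero>"
      unfolding S using t[of a] w[of a] by (simp add: m_assoc l_minus)
    finally show "(\<Oplus>s\<in>S. (w s \<otimes> (t s \<ominus> t a)) \<otimes> t s [^] m) = \<zero>" .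
  qed
  have wS: "w s = \<zero>" if "s \<in> S" for s
  proof -
    have "t s \<noteq> t a"
      using insert.prems(1) insert.hyps that by (auto simp: commuting_distinct_def inj_on_def)
    then show ?thesis
      using w'[OF that] t w that by (simp add: mult_eq_zero_iff diff_eq_zero_iff)
  qed
  have "(\<Oplus>s\<in>S. w s \<otimes> t s [^] (0::nat)) = \<zero>"
    using wS t by (intro add.finprod_one_eqI) auto
  then have "w a = \<zero>" using split[of 0] w[of a] by simp
  then show ?case using wS insert.prems(4) by auto
qed simp

lemma ad_mult_left:
  assumes "z \<in> carrier D" "p \<in> carrier D" "q \<in> carrier D"
  shows "ad (p \<otimes> q) z = ad p z \<otimes> q \<oplus> p \<otimes> ad q z"
  using assms ad_swap[of "p \<otimes> q" z] ad_swap[of p z] ad_swap[of q z]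
  by (simp add: ad_mult minus_add l_minus r_minus)

lemma ad_pow_zero:
  assumes "z \<in> carrier D" "p \<in> carrier D" "ad z p = \<zero>"
  shows "ad z (p [^] (m::nat)) = \<zero>"
  using ad_pow[of z p m] assms by simp

lemma ad_zero_swap: "\<lbrakk>z \<in> carrier D; p \<in> carrier D; ad z p = \<zero>\<rbrakk> \<Longrightarrow> ad p z = \<zero>"
  by (simp add: ad_eq_zero_iff)

lemma ad_finsum_left:
  assumes "z \<in> carrier D" "f \<in> A \<rightarrow> carrier D"
  shows "ad (\<Oplus>i\<in>A. f i) z = (\<Oplus>i\<in>A. ad (f i) z)"
  using assms(2)
proof (induction A rule: infinite_finite_induct)
  case (insert a A)
  then have "(\<lambda>i. ad (f i) z) \<in> A \<rightarrow> carrier D" using assms(1) by auto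
  with insert assms(1) show ?case by (simp add: ad_add_left)
qed (use assms(1) in \<open>auto simp: ad_zero_swap\<close>)

lemma ad_peval_left:
  assumes "z \<in> carrier D" "t \<in> carrier D" "ad t z = \<zero>" "\<And>i. i < n \<Longrightarrow> c i \<in> carrier D"
  shows "ad (peval n t c) z = peval n t (\<lambda>i. ad (c i) z)"
proof -
  have "ad (t [^] i) z = \<zero>" for i :: nat
    using assms(1-3) ad_zero_swap[of t z] ad_pow_zero[of z t i] ad_zero_swap[of z "t [^] i"] by simp
  then show ?thesis
    unfolding peval_def using assms
    by (subst ad_finsum_left) (auto intro!: finsum_cong' simp: ad_mult_left)
qed

lemma peval_delta:
  assumes "t \<in> carrier D" "m < n"
  shows "peval n t (\<lambda>i. if i = m then \<one> else \<zero>) = t [^] m"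
proof -
  have "peval n t (\<lambda>i. if i = m then \<one> else \<zero>) = (\<Oplus>i\<in>{..<n}. if m = i then t [^] i else \<zero>)"
    unfolding peval_def using assms by (intro finsum_cong') auto
  also have "\<dots> = t [^] m"
    using assms by (intro add.finprod_singleton) auto
  finally show ?thesis .
qed

lemma finsum_const_k:
  assumes "finite A" "z \<in> carrier D"
  shows "(\<Oplus>a\<in>A. z) = k (of_nat (card A)) \<otimes> z"
  using assms(1)
proof (induction A rule: finite_induct)
  case (insert a A)
  then show ?case using assms(2) by (simp add: k_add l_distr)
qed (use assms in simp)

lemma ring_hom_finsum:
  assumes "h \<in> ring_hom D D" "f \<in> A \<rightarrow> carrier D"
  shows "h (\<Oplus>a\<in>A. f a) = (\<Oplus>a\<in>A. h (f a))"
  using assms(2)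
proof (induction A rule: infinite_finite_induct)
  case (insert a A)
  then have "(\<lambda>a. h (f a)) \<in> A \<rightarrow> carrier D" using ring_hom_closed[OF assms(1)] by auto
  with insert show ?case
    using ring_hom_closed[OF assms(1)] ring_hom_add[OF assms(1)] by simp
qed (use ring_hom_sub_zero[OF assms(1)] in auto)

lemma ring_hom_pow:
  assumes "h \<in> ring_hom D D" "z \<in> carrier D"
  shows "h (z [^] (m::nat)) = h z [^] m"
  by (induction m) (use assms ring_hom_one[OF assms(1)] ring_hom_mult[OF assms(1)] in auto)

end

section \<open>The elements dual to the power sums\<close>

locale weyl_skew = skew_alg D k
  for D (structure) and k :: "'k::field_char_0 \<Rightarrow> 'b" +
  fixes n :: nat and x d :: "nat \<Rightarrow> 'b"
  assumes n_pos: "0 < n" and weyl: "weyl_system n x d" and frac: "fractions n x d"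
begin

lemma x_closed [simp]: "i < n \<Longrightarrow> x i \<in> carrier D"
  and d_closed [simp]: "i < n \<Longrightarrow> d i \<in> carrier D"
  and ad_x_x [simp]: "\<lbrakk>i < n; j < n\<rbrakk> \<Longrightarrow> ad (x i) (x j) = \<zero>"
  and ad_d_d [simp]: "\<lbrakk>i < n; j < n\<rbrakk> \<Longrightarrow> ad (d i) (d j) = \<zero>"
  and ad_d_x: "\<lbrakk>i < n; j < n\<rbrakk> \<Longrightarrow> ad (d i) (x j) = (if i = j then \<one> else \<zero>)"
  using weyl by (auto simp: weyl_systemD)

lemma x_comm: "\<lbrakk>i < n; j < n\<rbrakk> \<Longrightarrow> x i \<otimes> x j = x j \<otimes> x i"
  using ad_eq_zero_iff[of "x i" "x j"] by simp

lemma x_commuting_distinct: "commuting_distinct {..<n} x"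
proof -
  have "inj_on x {..<n}"
  proof (rule inj_onI)
    fix i j assume "i \<in> {..<n}" "j \<in> {..<n}" "x i = x j"
    \<comment> \<open>Equal generators have equal commutators with \<open>d i\<close>, which are
      \<one> and \<zero> if the indices differ.\<close>
    then show "i = j"
      using ad_d_x[of i i] ad_d_x[of i j] nontrivial by (auto split: if_splits)
  qed
  then show ?thesis by (auto simp: commuting_distinct_def x_comm)
qed

lemma ad_d_x_pow:
  assumes "j < n" "l < n"
  shows "ad (d j) (x l [^] (m::nat)) = (if j = l then k (of_nat m) \<otimes> x j [^] (m - 1) else \<zero>)"
  using ad_pow[of "d j" "x l" m] assms by (auto simp: ad_d_x)

definition power_sum :: "nat \<Rightarrow> 'b" where
  "power_sum a = (\<Oplus>j\<in>{..<n}. x j [^] a)"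

definition y :: "nat \<Rightarrow> 'b" where
  "y m = k (inverse (of_nat (Suc m))) \<otimes> power_sum (Suc m)"

definition b :: "nat \<Rightarrow> 'b" where
  "b = (SOME b. (\<forall>i<n. b i \<in> carrier D) \<and> (\<forall>j<n. peval n (x j) b = d j))"

lemma b_closed [simp]: "i < n \<Longrightarrow> b i \<in> carrier D"
  and peval_b: "j < n \<Longrightarrow> peval n (x j) b = d j"
proof -
  have "\<exists>b. (\<forall>i<n. b i \<in> carrier D) \<and> (\<forall>j<n. peval n (x j) b = d j)"
    by (rule vandermonde_exists[OF x_commuting_distinct]) simp
  then have "(\<forall>i<n. b i \<in> carrier D) \<and> (\<forall>j<n. peval n (x j) b = d j)"
    unfolding b_def by (rule someI_ex)
  then show "i < n \<Longrightarrow> b i \<in> carrier D" "j < n \<Longrightarrow> peval n (x j) b = d j" by auto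
qed

lemma power_sum_closed [simp]: "power_sum a \<in> carrier D"
  unfolding power_sum_def by (intro finsum_closed) auto

lemma y_closed [simp]: "y m \<in> carrier D"
  by (simp add: y_def)

lemma ad_k_mult: "\<lbrakk>z \<in> carrier D; p \<in> carrier D\<rbrakk> \<Longrightarrow> ad z (k c \<otimes> p) = k c \<otimes> ad z p"
  by (simp add: ad_mult)

lemma ad_d_y:
  assumes "j < n"
  shows "ad (d j) (y m) = x j [^] m"
proof -
  have "ad (d j) (power_sum (Suc m)) = (\<Oplus>l\<in>{..<n}. ad (d j) (x l [^] Suc m))"
    unfolding power_sum_def by (rule ad_finsum) (use assms in auto)
  also have "\<dots> = (\<Oplus>l\<in>{..<n}. if j = l then k (of_nat (Suc m)) \<otimes> x l [^] m else \<zero>)"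
    by (rule finsum_cong') (use assms ad_d_x_pow[OF assms, of _ "Suc m"] in \<open>auto simp del: nat_pow_Suc of_nat_Suc\<close>)
  also have "\<dots> = k (of_nat (Suc m)) \<otimes> x j [^] m"
    by (rule add.finprod_singleton) (use assms in auto)
  finally have "ad (d j) (power_sum (Suc m)) = k (of_nat (Suc m)) \<otimes> x j [^] m" .
  moreover have "k (inverse (of_nat (Suc m))) \<otimes> k (of_nat (Suc m)) = \<one>"
    using k_mult[of "inverse (of_nat (Suc m))" "of_nat (Suc m)"] by (simp del: of_nat_Suc)
  ultimately show ?thesis
    using assms by (simp add: y_def ad_k_mult m_assoc[symmetric] del: of_nat_Suc)
qed

lemma ad_x_power_sum: "j < n \<Longrightarrow> ad (x j) (power_sum a) = \<zero>"
  unfolding power_sum_def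
  by (subst ad_finsum) (auto intro!: add.finprod_one_eqI ad_pow_zero)

lemma ad_power_sum_power_sum: "ad (power_sum a) (power_sum c) = \<zero>"
proof -
  have "ad (power_sum a) (x j) = \<zero>" if "j < n" for j
    using that by (intro ad_zero_swap[OF _ _ ad_x_power_sum]) auto
  then show ?thesis
    unfolding power_sum_def[of c]
    by (subst ad_finsum) (auto intro!: add.finprod_one_eqI ad_pow_zero)
qed

lemma ad_y_y: "ad (y m) (y l) = \<zero>"
proof -
  have "ad (power_sum c) (y m) = \<zero>" for c
    by (simp add: y_def ad_k_mult ad_power_sum_power_sum)
  then have "ad (y m) (power_sum (Suc l)) = \<zero>"
    using ad_zero_swap[of "power_sum (Suc l)" "y m"] by simp
  then show ?thesis
    by (simp add: y_def[of l] ad_k_mult)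
qed

lemma ad_x_y: "j < n \<Longrightarrow> ad (x j) (y m) = \<zero>"
  unfolding y_def by (simp add: ad_k_mult ad_x_power_sum)

text \<open>Taking the commutator of the defining system with \<open>y m\<close>, which commutes
  with every node, gives a Vandermonde system for these commutators; the Kronecker delta solves it
  as well.\<close>

lemma ad_b_y:
  assumes "i < n" "m < n"
  shows "ad (b i) (y m) = (if i = m then \<one> else \<zero>)"
proof (rule vandermonde_unique[OF x_commuting_distinct _ _ _ assms(1),
      of "\<lambda>i. ad (b i) (y m)" "\<lambda>i. if i = m then \<one> else \<zero>"])
  fix j assume j: "j < n"
  have "peval n (x j) (\<lambda>i. ad (b i) (y m)) = ad (peval n (x j) b) (y m)"
    using j by (intro ad_peval_left[symmetric]) (auto simp: ad_x_y)
  also have "\<dots> = x j [^] m"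
    using j by (simp add: peval_b ad_d_y)
  finally show "peval n (x j) (\<lambda>i. ad (b i) (y m)) = peval n (x j) (\<lambda>i. if i = m then \<one> else \<zero>)"
    using j assms by (simp add: peval_delta)
qed auto

text \<open>Both sides are determined by their values under the interpolation at all nodes \<open>x l\<close>.\<close>

lemma ad_b_d:
  assumes "m < n" "j < n"
  shows "ad (b m) (d j) = (\<Oplus>i\<in>{..<n}. ad (b m) (x j [^] i) \<otimes> b i)"
proof (rule vandermonde_unique[OF x_commuting_distinct _ _ _ assms(1),
      of "\<lambda>m. ad (b m) (d j)" "\<lambda>m. \<Oplus>i\<in>{..<n}. ad (b m) (x j [^] i) \<otimes> b i"])
  fix l assume l: "l < n"
  define U where "U = (\<Oplus>m\<in>{..<n}. ad (d j) (x l [^] m) \<otimes> b m)"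
  have Uc: "U \<in> carrier D" unfolding U_def using assms l by (intro finsum_closed) auto
  have Pc: "peval n (x l) (\<lambda>m. ad (b m) (d j)) \<in> carrier D" using assms l by auto
  have tm: "ad (d j) (x l [^] m \<otimes> b m) =
      ad (d j) (x l [^] m) \<otimes> b m \<ominus> x l [^] m \<otimes> ad (b m) (d j)" if "m < n" for m
    using assms l that ad_swap[of "d j" "b m"] by (simp add: ad_mult minus_eq r_minus)
  \<comment> \<open>The Leibniz rule is applied to [d_j, d_l] = 0 with \<open>d l\<close> written as
    the interpolation at \<open>x l\<close>.\<close>
  have "\<zero> = ad (d j) (peval n (x l) b)" using assms l by (simp add: peval_b)
  also have "\<dots> = (\<Oplus>m\<in>{..<n}. ad (d j) (x l [^] m) \<otimes> b m \<ominus> x l [^] m \<otimes> ad (b m) (d j))"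
    unfolding peval_def using assms l tm
    by (subst ad_finsum) (auto intro!: finsum_cong')
  also have "\<dots> = U \<ominus> peval n (x l) (\<lambda>m. ad (b m) (d j))"
    unfolding U_def peval_def using assms l by (intro finsum_diff) auto
  finally have 1: "peval n (x l) (\<lambda>m. ad (b m) (d j)) = U"
    using diff_eq_zero_iff[OF Uc Pc] by simp
  \<comment> \<open>After exchanging the two sums, the sum over \<open>m\<close> becomes the
    commutator of \<open>d l\<close> with \<open>x j [^] i\<close>.\<close>
  have "peval n (x l) (\<lambda>m. \<Oplus>i\<in>{..<n}. ad (b m) (x j [^] i) \<otimes> b i) =
      (\<Oplus>m\<in>{..<n}. \<Oplus>i\<in>{..<n}. x l [^] m \<otimes> ad (b m) (x j [^] i) \<otimes> b i)"
    unfolding peval_def using assms l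
    by (intro finsum_cong') (auto intro!: finsum_closed finsum_cong' simp: finsum_rdistr m_assoc)
  also have "\<dots> = (\<Oplus>i\<in>{..<n}. \<Oplus>m\<in>{..<n}. x l [^] m \<otimes> ad (b m) (x j [^] i) \<otimes> b i)"
    using assms l by (intro finsum_swap) auto
  also have "\<dots> = (\<Oplus>i\<in>{..<n}. ad (d j) (x l [^] i) \<otimes> b i)"
  proof (rule finsum_cong'[OF refl])
    fix i assume i: "i \<in> {..<n}"
    have "(\<Oplus>m\<in>{..<n}. x l [^] m \<otimes> ad (b m) (x j [^] i) \<otimes> b i) =
        peval n (x l) (\<lambda>m. ad (b m) (x j [^] i)) \<otimes> b i"
      unfolding peval_def using assms l i by (intro finsum_ldistr[symmetric]) auto
    also have "peval n (x l) (\<lambda>m. ad (b m) (x j [^] i)) = ad (peval n (x l) b) (x j [^] i)"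
      using assms l by (intro ad_peval_left[symmetric]) (auto intro!: ad_pow_zero)
    \<comment> \<open>Both commutators vanish if \<open>j \<noteq> l\<close>, and they are the same
      expression if \<open>j = l\<close>.\<close>
    also have "\<dots> = ad (d j) (x l [^] i)"
      using assms l by (auto simp: peval_b ad_d_x_pow)
    finally show "(\<Oplus>m\<in>{..<n}. x l [^] m \<otimes> ad (b m) (x j [^] i) \<otimes> b i) = ad (d j) (x l [^] i) \<otimes> b i" .
  qed (use assms l in auto)
  also have "\<dots> = U" by (simp add: U_def)
  finally show "peval n (x l) (\<lambda>m. ad (b m) (d j)) =
      peval n (x l) (\<lambda>m. \<Oplus>i\<in>{..<n}. ad (b m) (x j [^] i) \<otimes> b i)"
    using 1 by simp
qed (use assms in \<open>auto intro!: finsum_closed\<close>)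

text \<open>Expand [b_m, d_j] by the Leibniz rule along the interpolation of \<open>d j\<close>. By
  \<open>ad_b_d\<close> the terms that differentiate the powers of \<open>x j\<close> already
  account for the whole commutator, so the remaining interpolation with coefficients [b_m, b_i]
  vanishes at every node.\<close>

lemma ad_b_b:
  assumes "m < n" "i < n"
  shows "ad (b m) (b i) = \<zero>"
proof (rule vandermonde_zero[OF x_commuting_distinct _ _ assms(2), of "\<lambda>i. ad (b m) (b i)"])
  fix j assume j: "j < n"
  define U where "U = (\<Oplus>i\<in>{..<n}. ad (b m) (x j [^] i) \<otimes> b i)"
  have c: "U \<in> carrier D" "peval n (x j) (\<lambda>i. ad (b m) (b i)) \<in> carrier D"
    unfolding U_def using assms j by (auto intro!: finsum_closed)
  have "U = ad (b m) (peval n (x j) b)"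
    using ad_b_d[OF assms(1) j] j by (simp add: U_def peval_b)
  also have "\<dots> = (\<Oplus>i\<in>{..<n}. ad (b m) (x j [^] i \<otimes> b i))"
    unfolding peval_def using assms j by (intro ad_finsum) auto
  also have "\<dots> = (\<Oplus>i\<in>{..<n}. ad (b m) (x j [^] i) \<otimes> b i \<oplus> x j [^] i \<otimes> ad (b m) (b i))"
    by (rule finsum_cong') (use assms j in \<open>auto simp: ad_mult\<close>)
  also have "\<dots> = U \<oplus> peval n (x j) (\<lambda>i. ad (b m) (b i))"
    unfolding U_def peval_def using assms j by (intro finsum_addf) auto
  finally show "peval n (x j) (\<lambda>i. ad (b m) (b i)) = \<zero>"
    using c by simp
qed (use assms in auto)

lemma weyl_dual: "weyl_system n y b"
  unfolding weyl_system_def by (simp add: ad_y_y ad_b_b ad_b_y)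

section \<open>Power sums and Newton identities\<close>

definition Phi :: "'b \<Rightarrow> 'b" where
  "Phi = (SOME h. h \<in> ring_hom D D \<and> (\<forall>c. h (k c) = k c) \<and> (\<forall>i<n. h (x i) = y i \<and> h (d i) = b i))"

lemma Phi_hom: "Phi \<in> ring_hom D D"
  and Phi_k [simp]: "Phi (k c) = k c"
  and Phi_x [simp]: "i < n \<Longrightarrow> Phi (x i) = y i"
  and Phi_d [simp]: "i < n \<Longrightarrow> Phi (d i) = b i"
proof -
  have "\<exists>h. h \<in> ring_hom D D \<and> (\<forall>c. h (k c) = k c) \<and> (\<forall>i<n. h (x i) = y i \<and> h (d i) = b i)"
    using weyl_hom_exists[OF weyl weyl_dual frac] by blast
  then have "Phi \<in> ring_hom D D \<and> (\<forall>c. Phi (k c) = k c) \<and> (\<forall>i<n. Phi (x i) = y i \<and> Phi (d i) = b i)"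
    unfolding Phi_def by (rule someI_ex)
  then show "Phi \<in> ring_hom D D" "Phi (k c) = k c" "i < n \<Longrightarrow> Phi (x i) = y i" "i < n \<Longrightarrow> Phi (d i) = b i"
    by auto
qed

definition L :: "'b set" where
  "L = Phi ` carrier D"

lemma L_closed: "z \<in> L \<Longrightarrow> z \<in> carrier D"
  using ring_hom_closed[OF Phi_hom] by (auto simp: L_def)

lemma L_k [simp]: "k c \<in> L"
  unfolding L_def by (rule image_eqI[of _ _ "k c"]) auto

lemma L_zero [simp]: "\<zero> \<in> L" using L_k[of 0] by simp

lemma L_one [simp]: "\<one> \<in> L" using L_k[of 1] by simp

lemma L_add: "z \<in> L \<Longrightarrow> w \<in> L \<Longrightarrow> z \<oplus> w \<in> L"
  unfolding L_def by (auto simp: ring_hom_add[OF Phi_hom, symmetric])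

lemma L_mult: "z \<in> L \<Longrightarrow> w \<in> L \<Longrightarrow> z \<otimes> w \<in> L"
  unfolding L_def by (auto simp: ring_hom_mult[OF Phi_hom, symmetric])

lemma L_diff:
  assumes "z \<in> L" "w \<in> L"
  shows "z \<ominus> w \<in> L"
proof -
  have "z \<oplus> k (- 1) \<otimes> w \<in> L" by (intro L_add L_mult assms L_k)
  then show ?thesis using assms L_closed by (simp add: k_uminus l_minus minus_eq)
qed

lemma L_finsum: "(\<And>a. a \<in> A \<Longrightarrow> f a \<in> L) \<Longrightarrow> (\<Oplus>a\<in>A. f a) \<in> L"
proof (induction A rule: infinite_finite_induct)
  case (insert a A)
  then show ?case
    by (subst finsum_insert) (auto intro!: L_add simp: L_closed)
qed auto

lemma L_inv:
  assumes "z \<in> L" "z \<noteq> \<zero>"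
  shows "inv z \<in> L"
proof -
  obtain w where w: "w \<in> carrier D" "z = Phi w" using assms by (auto simp: L_def)
  have u: "w \<in> Units D" using assms w units ring_hom_sub_zero[OF Phi_hom] by metis
  have "z \<otimes> Phi (inv w) = Phi (w \<otimes> inv w)" "Phi (inv w) \<otimes> z = Phi (inv w \<otimes> w)"
    using u w ring_hom_mult[OF Phi_hom Units_closed[OF u] Units_inv_closed[OF u]]
      ring_hom_mult[OF Phi_hom Units_inv_closed[OF u] Units_closed[OF u]] by simp_all
  then have "z \<otimes> Phi (inv w) = \<one>" "Phi (inv w) \<otimes> z = \<one>"
    using u ring_hom_one[OF Phi_hom] by simp_all
  then have "inv z = Phi (inv w)"
    using L_closed assms(1) ring_hom_closed[OF Phi_hom] u by (intro inv_char) auto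
  then show ?thesis using u by (auto simp: L_def)
qed

lemma L_k_mult_iff:
  assumes "c \<noteq> 0" "z \<in> carrier D"
  shows "k c \<otimes> z \<in> L \<longleftrightarrow> z \<in> L"
proof
  assume "k c \<otimes> z \<in> L"
  then have "k (inverse c) \<otimes> (k c \<otimes> z) \<in> L" by (rule L_mult[OF L_k])
  then show "z \<in> L" using assms k_mult[of "inverse c" c, symmetric] by (simp add: m_assoc[symmetric])
qed (auto intro: L_mult)

lemma L_y: "m < n \<Longrightarrow> y m \<in> L"
  unfolding L_def by (rule image_eqI[of _ _ "x m"]) auto

lemma L_b: "m < n \<Longrightarrow> b m \<in> L"
  unfolding L_def by (rule image_eqI[of _ _ "d m"]) auto

lemma L_power_sum_le:
  assumes "a \<le> n"
  shows "power_sum a \<in> L"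
proof (cases a)
  case 0
  then have "power_sum a = k (of_nat n)"
    unfolding power_sum_def by (simp add: finsum_const_k)
  then show ?thesis by simp
next
  case (Suc m)
  then show ?thesis
    using L_y[of m] assms L_k_mult_iff[of "inverse (of_nat (Suc m))" "power_sum a"]
    by (simp add: y_def del: of_nat_Suc)
qed

text \<open>Elementary symmetric function of degree \<open>c\<close> in the first \<open>m\<close>
  variables, split according to whether a monomial contains the last one.\<close>

fun elem_sym :: "nat \<Rightarrow> nat \<Rightarrow> 'b" where
  "elem_sym m 0 = \<one>"
| "elem_sym 0 (Suc c) = \<zero>"
| "elem_sym (Suc m) (Suc c) = elem_sym m (Suc c) \<oplus> x m \<otimes> elem_sym m c"

text \<open>For \<^prop>\<open>j < m\<close> this is the elementary symmetric function of degree \<open>c\<close> in the variables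
  other than \<^term>\<open>x j\<close>.\<close>

primrec elem_sym_omit :: "nat \<Rightarrow> nat \<Rightarrow> nat \<Rightarrow> 'b" where
  "elem_sym_omit m j 0 = \<one>"
| "elem_sym_omit m j (Suc c) = elem_sym m (Suc c) \<ominus> x j \<otimes> elem_sym_omit m j c"

lemma elem_sym_closed [simp]: "m \<le> n \<Longrightarrow> elem_sym m c \<in> carrier D"
  by (induction m c rule: elem_sym.induct) auto

lemma elem_sym_omit_closed [simp]: "m \<le> n \<Longrightarrow> j < n \<Longrightarrow> elem_sym_omit m j c \<in> carrier D"
  by (induction c) auto

lemma elem_sym_zero: "m < c \<Longrightarrow> m \<le> n \<Longrightarrow> elem_sym m c = \<zero>"
  by (induction m c rule: elem_sym.induct) auto

lemma elem_sym_omit_last: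
  assumes "m < n"
  shows "elem_sym_omit (Suc m) m c = elem_sym m c"
  by (induction c) (use assms in \<open>auto simp: minus_eq a_assoc r_neg\<close>)

text \<open>In generating functions, omitting \<open>x j\<close> is division by 1 + x_j t, and it
  commutes with multiplication by the new factor 1 + x_m t.\<close>

lemma elem_sym_omit_Suc:
  assumes "m < n" "j < n"
  shows "elem_sym_omit (Suc m) j (Suc c) = elem_sym_omit m j (Suc c) \<oplus> x m \<otimes> elem_sym_omit m j c"
proof (induction c)
  case 0
  then show ?case using assms by (simp add: minus_eq a_ac)
next
  case (Suc c)
  define e e' r r' where "e = elem_sym m (Suc (Suc c))" "e' = elem_sym m (Suc c)"
    "r = elem_sym_omit m j (Suc c)" "r' = elem_sym_omit m j c"
  have c: "e \<in> carrier D" "e' \<in> carrier D" "r \<in> carrier D" "r' \<in> carrier D"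
    "x m \<in> carrier D" "x j \<in> carrier D"
    using assms unfolding e_e'_r_r'_def by (auto simp del: elem_sym_omit.simps)
  have r: "r = e' \<ominus> x j \<otimes> r'" by (simp add: e_e'_r_r'_def)
  have "elem_sym_omit (Suc m) j (Suc (Suc c)) = (e \<oplus> x m \<otimes> e') \<ominus> x j \<otimes> (r \<oplus> x m \<otimes> r')"
    using Suc by (subst elem_sym_omit.simps) (simp add: e_e'_r_r'_def del: elem_sym_omit.simps)
  also have "x j \<otimes> (r \<oplus> x m \<otimes> r') = x j \<otimes> r \<oplus> x m \<otimes> (x j \<otimes> r')"
    using c x_comm[OF assms] by (simp add: r_distr m_assoc[symmetric])
  also have "(e \<oplus> x m \<otimes> e') \<ominus> (x j \<otimes> r \<oplus> x m \<otimes> (x j \<otimes> r')) = (e \<ominus> x j \<otimes> r) \<oplus> x m \<otimes> r"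
    using c unfolding r by (simp add: minus_eq minus_add r_distr r_minus l_minus a_ac)
  finally show ?case by (simp add: e_e'_r_r'_def)
qed

text \<open>Each squarefree monomial of degree \<open>Suc c\<close> arises once for every variable
  it contains, as that variable times the rest.\<close>

lemma newton_identity:
  assumes "m \<le> n"
  shows "(\<Oplus>j\<in>{..<m}. x j \<otimes> elem_sym_omit m j c) = k (of_nat (Suc c)) \<otimes> elem_sym m (Suc c)"
  using assms
proof (induction m arbitrary: c)
  case (Suc m)
  have m: "m < n" and IH: "\<And>c. (\<Oplus>j\<in>{..<m}. x j \<otimes> elem_sym_omit m j c) = k (of_nat (Suc c)) \<otimes> elem_sym m (Suc c)"
    using Suc by auto
  have split: "(\<Oplus>j\<in>{..<Suc m}. x j \<otimes> elem_sym_omit (Suc m) j c) =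
      x m \<otimes> elem_sym m c \<oplus> (\<Oplus>j\<in>{..<m}. x j \<otimes> elem_sym_omit (Suc m) j c)"
    using m unfolding lessThan_Suc elem_sym_omit_last[OF m, symmetric]
    by (intro finsum_insert) auto
  show ?case
  proof (cases c)
    case 0
    then show ?thesis using split IH[of 0] m by (simp add: a_comm)
  next
    case (Suc c')
    define e e' where "e = elem_sym m (Suc c)" "e' = elem_sym m c"
    have ec: "e \<in> carrier D" "e' \<in> carrier D" using m by (auto simp: e_e'_def)
    have "(\<Oplus>j\<in>{..<m}. x j \<otimes> elem_sym_omit (Suc m) j c) =
        (\<Oplus>j\<in>{..<m}. x j \<otimes> elem_sym_omit m j c \<oplus> x m \<otimes> (x j \<otimes> elem_sym_omit m j c'))"
    proof (rule finsum_cong'[OF refl])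
      fix j assume "j \<in> {..<m}"
      then have j: "j < n" using m by auto
      have cl: "elem_sym_omit m j c \<in> carrier D" "elem_sym_omit m j c' \<in> carrier D"
        using m j by auto
      have "x j \<otimes> elem_sym_omit (Suc m) j c = x j \<otimes> (elem_sym_omit m j c \<oplus> x m \<otimes> elem_sym_omit m j c')"
        unfolding Suc elem_sym_omit_Suc[OF m j] ..
      also have "\<dots> = x j \<otimes> elem_sym_omit m j c \<oplus> x m \<otimes> (x j \<otimes> elem_sym_omit m j c')"
        using cl m j x_comm[OF m j] by (simp add: r_distr m_assoc[symmetric])
      finally show "x j \<otimes> elem_sym_omit (Suc m) j c =
          x j \<otimes> elem_sym_omit m j c \<oplus> x m \<otimes> (x j \<otimes> elem_sym_omit m j c')" .
    qed (use m in auto)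
    also have "\<dots> = (\<Oplus>j\<in>{..<m}. x j \<otimes> elem_sym_omit m j c) \<oplus> (\<Oplus>j\<in>{..<m}. x m \<otimes> (x j \<otimes> elem_sym_omit m j c'))"
      using m by (intro finsum_addf) auto
    also have "(\<Oplus>j\<in>{..<m}. x m \<otimes> (x j \<otimes> elem_sym_omit m j c')) = x m \<otimes> (\<Oplus>j\<in>{..<m}. x j \<otimes> elem_sym_omit m j c')"
      using m by (intro finsum_rdistr[symmetric]) auto
    also have "\<dots> = k (of_nat c) \<otimes> (x m \<otimes> e')"
      unfolding IH using m ec by (simp add: Suc e_e'_def k_left_commute)
    also have "(\<Oplus>j\<in>{..<m}. x j \<otimes> elem_sym_omit m j c) = k (of_nat (Suc c)) \<otimes> e"
      unfolding IH e_e'_def ..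
    finally have "(\<Oplus>j\<in>{..<Suc m}. x j \<otimes> elem_sym_omit (Suc m) j c) =
        x m \<otimes> e' \<oplus> (k (of_nat (Suc c)) \<otimes> e \<oplus> k (of_nat c) \<otimes> (x m \<otimes> e'))"
      unfolding split e_e'_def by simp
    also have "\<dots> = k (of_nat (Suc c)) \<otimes> e \<oplus> k (of_nat (Suc c)) \<otimes> (x m \<otimes> e')"
      unfolding k_Suc[of c] using ec m by (simp add: l_distr a_ac del: of_nat_Suc)
    also have "\<dots> = k (of_nat (Suc c)) \<otimes> elem_sym (Suc m) (Suc c)"
      using ec m by (simp add: e_e'_def r_distr del: of_nat_Suc)
    finally show ?thesis .
  qed
qed simp

text \<open>Interpolates between the two families of symmetric functions: \<open>c = 0\<close> gives
  a power sum, and \<open>a = 1\<close> gives a multiple of an elementary symmetric function by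
  \<open>newton_identity\<close>. Lowering \<open>c\<close> while raising \<open>a\<close> connects
  the two ends.\<close>

definition mixed_sum :: "nat \<Rightarrow> nat \<Rightarrow> 'b" where
  "mixed_sum a c = (\<Oplus>j\<in>{..<n}. x j [^] a \<otimes> elem_sym_omit n j c)"

lemma mixed_sum_closed [simp]: "mixed_sum a c \<in> carrier D"
  unfolding mixed_sum_def by (intro finsum_closed) auto

lemma mixed_sum_0: "mixed_sum a 0 = power_sum a"
  unfolding mixed_sum_def power_sum_def by (intro finsum_cong') auto

lemma mixed_sum_Suc: "mixed_sum a (Suc c) = power_sum a \<otimes> elem_sym n (Suc c) \<ominus> mixed_sum (Suc a) c"
proof -
  have "mixed_sum a (Suc c) =
      (\<Oplus>j\<in>{..<n}. x j [^] a \<otimes> elem_sym n (Suc c) \<ominus> x j [^] Suc a \<otimes> elem_sym_omit n j c)"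
    unfolding mixed_sum_def by (intro finsum_cong') (auto simp: right_diff_distrib m_assoc)
  also have "\<dots> = (\<Oplus>j\<in>{..<n}. x j [^] a \<otimes> elem_sym n (Suc c)) \<ominus> mixed_sum (Suc a) c"
    unfolding mixed_sum_def by (intro finsum_diff) auto
  also have "(\<Oplus>j\<in>{..<n}. x j [^] a \<otimes> elem_sym n (Suc c)) = power_sum a \<otimes> elem_sym n (Suc c)"
    unfolding power_sum_def by (intro finsum_ldistr[symmetric]) auto
  finally show ?thesis .
qed

lemma L_diff_iff:
  assumes "z \<in> L" "w \<in> carrier D"
  shows "z \<ominus> w \<in> L \<longleftrightarrow> w \<in> L"
proof
  assume "z \<ominus> w \<in> L"
  then have "z \<ominus> (z \<ominus> w) \<in> L" using assms L_diff by blast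
  moreover have "z \<ominus> (z \<ominus> w) = w"
    using assms L_closed[OF assms(1)] by (simp add: minus_eq minus_add r_neg2 a_assoc[symmetric] r_neg)
  ultimately show "w \<in> L" by simp
qed (use assms L_diff in blast)

text \<open>Each use of \<open>mixed_sum_Suc\<close> changes the sign and adds a product of a power
  sum and an elementary symmetric function already known to lie in \<open>L\<close>.\<close>

lemma L_mixed_sum_iff:
  assumes "\<And>i. i \<le> c \<Longrightarrow> elem_sym n i \<in> L" "\<And>i. a \<le> i \<Longrightarrow> i < a + c \<Longrightarrow> power_sum i \<in> L"
  shows "mixed_sum a c \<in> L \<longleftrightarrow> power_sum (a + c) \<in> L"
  using assms
proof (induction c arbitrary: a)
  case (Suc c)
  have "mixed_sum a (Suc c) \<in> L \<longleftrightarrow> mixed_sum (Suc a) c \<in> L"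
    unfolding mixed_sum_Suc using Suc.prems by (intro L_diff_iff L_mult) auto
  also have "\<dots> \<longleftrightarrow> power_sum (Suc a + c) \<in> L"
    using Suc.prems by (intro Suc.IH) auto
  finally show ?case by simp
qed (simp add: mixed_sum_0)

text \<open>Once all smaller degrees are known, Newton's identity makes the two memberships
  equivalent, and one of them is always available: the power sum comes from a generator for
  \<open>c \<le> n\<close>, and the elementary symmetric function is zero beyond.\<close>

lemma L_elem_sym_power_sum: "elem_sym n c \<in> L \<and> power_sum c \<in> L"
proof (induction c rule: less_induct)
  case (less c)
  show ?case
  proof (cases c)
    case 0
    then show ?thesis using L_power_sum_le by simp
  next
    case (Suc c')
    have "mixed_sum 1 c' = (\<Oplus>j\<in>{..<n}. x j \<otimes> elem_sym_omit n j c')"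
      unfolding mixed_sum_def by (intro finsum_cong') auto
    then have eq: "mixed_sum 1 c' = k (of_nat c) \<otimes> elem_sym n c"
      using newton_identity[of n c'] Suc by simp
    have "mixed_sum 1 c' \<in> L \<longleftrightarrow> power_sum (1 + c') \<in> L"
      using less Suc by (intro L_mixed_sum_iff) auto
    then have iff: "elem_sym n c \<in> L \<longleftrightarrow> power_sum c \<in> L"
      unfolding eq using Suc L_k_mult_iff[of "of_nat c" "elem_sym n c"] by (simp del: of_nat_Suc)
    show ?thesis
    proof (cases "c \<le> n")
      case True
      then show ?thesis using iff L_power_sum_le by simp
    next
      case False
      then show ?thesis using iff elem_sym_zero[of n c] by simp
    qed
  qed
qed

section \<open>Polarised power sums\<close>

text \<open>Elements of the first Weyl algebra, viewed as functions of the position at which its copy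
  sits inside the \<open>n\<close>-th one.\<close>

inductive_set words :: "(nat \<Rightarrow> 'b) set" where
  scalar: "(\<lambda>j. k c) \<in> words"
| gen_x: "x \<in> words"
| gen_d: "d \<in> words"
| add: "r \<in> words \<Longrightarrow> s \<in> words \<Longrightarrow> (\<lambda>j. r j \<oplus> s j) \<in> words"
| mult: "r \<in> words \<Longrightarrow> s \<in> words \<Longrightarrow> (\<lambda>j. r j \<otimes> s j) \<in> words"

text \<open>Filtration by the order in \<open>d\<close>, with \<open>d\<close> on the right so that
  the last one can be expanded by interpolation. The clause \<open>ext_eq\<close> is there because
  only the values at places below \<open>n\<close> obey the Weyl relations.\<close>

inductive words_of_degree :: "nat \<Rightarrow> (nat \<Rightarrow> 'b) \<Rightarrow> bool" where
  pow: "words_of_degree m (\<lambda>j. k c \<otimes> x j [^] (a::nat))"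
| add: "words_of_degree m r \<Longrightarrow> words_of_degree m s \<Longrightarrow> words_of_degree m (\<lambda>j. r j \<oplus> s j)"
| mult_d: "words_of_degree m r \<Longrightarrow> words_of_degree (Suc m) (\<lambda>j. r j \<otimes> d j)"
| ext_eq: "words_of_degree m r \<Longrightarrow> (\<And>j. j < n \<Longrightarrow> s j = r j) \<Longrightarrow> words_of_degree m s"

lemma words_closed: "r \<in> words \<Longrightarrow> j < n \<Longrightarrow> r j \<in> carrier D"
  by (induction rule: words.induct) auto

lemma words_of_degree_closed: "words_of_degree m r \<Longrightarrow> j < n \<Longrightarrow> r j \<in> carrier D"
  by (induction rule: words_of_degree.induct) auto

lemma words_of_degree_Suc: "words_of_degree m r \<Longrightarrow> words_of_degree (Suc m) r"
  by (induction rule: words_of_degree.induct) (auto intro: words_of_degree.intros)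

lemma words_of_degree_mono: "m \<le> m' \<Longrightarrow> words_of_degree m r \<Longrightarrow> words_of_degree m' r"
  by (induction rule: dec_induct) (auto intro: words_of_degree_Suc)

lemma words_of_degree_mult_k:
  "words_of_degree m r \<Longrightarrow> words_of_degree m (\<lambda>j. r j \<otimes> k c)"
proof (induction rule: words_of_degree.induct)
  case (pow m c' a)
  show ?case
  proof (rule words_of_degree.ext_eq[OF words_of_degree.pow[of m "c' * c" a]])
    fix j assume "j < n"
    then show "k c' \<otimes> x j [^] a \<otimes> k c = k (c' * c) \<otimes> x j [^] a"
      using k_central[of "x j [^] a" c] by (simp add: k_mult m_assoc)
  qed
next
  case (add m r s)
  show ?case
    by (rule words_of_degree.ext_eq[OF words_of_degree.add[OF add.IH]])
      (use words_of_degree_closed[OF add.hyps(1)] words_of_degree_closed[OF add.hyps(2)] in \<open>simp add: l_distr\<close>)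
next
  case (mult_d m r)
  show ?case
    by (rule words_of_degree.ext_eq[OF words_of_degree.mult_d[OF mult_d.IH]])
      (use words_of_degree_closed[OF mult_d.hyps] in \<open>simp add: m_assoc k_central\<close>)
next
  case (ext_eq m r s)
  show ?case
    by (rule words_of_degree.ext_eq[OF ext_eq.IH]) (use ext_eq.hyps in simp)
qed

lemma d_mult_x: "j < n \<Longrightarrow> d j \<otimes> x j = x j \<otimes> d j \<oplus> \<one>"
  using commute_ad[of "d j" "x j"] by (simp add: ad_d_x)

text \<open>Moving \<open>x\<close> past a final \<open>d\<close> costs only a term of smaller
  order. Without this the powers of \<open>x\<close> created by interpolation would spoil the
  induction on the degree.\<close>

lemma words_of_degree_mult_x:
  "words_of_degree m r \<Longrightarrow> words_of_degree m (\<lambda>j. r j \<otimes> x j)"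
proof (induction rule: words_of_degree.induct)
  case (pow m c a)
  show ?case
    by (rule words_of_degree.ext_eq[OF words_of_degree.pow[of m c "Suc a"]])
      (simp add: m_assoc)
next
  case (add m r s)
  show ?case
    by (rule words_of_degree.ext_eq[OF words_of_degree.add[OF add.IH]])
      (use words_of_degree_closed[OF add.hyps(1)] words_of_degree_closed[OF add.hyps(2)] in \<open>simp add: l_distr\<close>)
next
  case (mult_d m r)
  show ?case
  proof (rule words_of_degree.ext_eq[OF words_of_degree.add[OF words_of_degree.mult_d[OF mult_d.IH]
          words_of_degree_Suc[OF mult_d.hyps]]])
    fix j assume j: "j < n"
    then have "r j \<in> carrier D" using mult_d.hyps words_of_degree_closed by blast
    then show "r j \<otimes> d j \<otimes> x j = r j \<otimes> x j \<otimes> d j \<oplus> r j"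
      using j by (simp add: m_assoc d_mult_x r_distr)
  qed
next
  case (ext_eq m r s)
  show ?case
    by (rule words_of_degree.ext_eq[OF ext_eq.IH]) (use ext_eq.hyps in simp)
qed

lemma words_of_degree_mult_x_pow:
  assumes "words_of_degree m r"
  shows "words_of_degree m (\<lambda>j. r j \<otimes> x j [^] (i::nat))"
proof (induction i)
  case 0
  show ?case by (rule words_of_degree.ext_eq[OF assms]) (use words_of_degree_closed[OF assms] in simp)
next
  case (Suc i)
  show ?case
    by (rule words_of_degree.ext_eq[OF words_of_degree_mult_x[OF Suc]])
      (use words_of_degree_closed[OF assms] in \<open>simp add: m_assoc\<close>)
qed

lemma words_of_degree_mult_word:
  assumes "s \<in> words"
  shows "words_of_degree m r \<Longrightarrow> \<exists>m'. words_of_degree m' (\<lambda>j. r j \<otimes> s j)"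
  using assms
proof (induction arbitrary: m r rule: words.induct)
  case (scalar c)
  then show ?case using words_of_degree_mult_k by blast
next
  case gen_x
  then show ?case using words_of_degree_mult_x by blast
next
  case gen_d
  then show ?case using words_of_degree.mult_d by blast
next
  case (add s t)
  obtain m1 m2 where "words_of_degree m1 (\<lambda>j. r j \<otimes> s j)" "words_of_degree m2 (\<lambda>j. r j \<otimes> t j)"
    using add.IH add.prems by blast
  then have 1: "words_of_degree (max m1 m2) (\<lambda>j. r j \<otimes> s j)" "words_of_degree (max m1 m2) (\<lambda>j. r j \<otimes> t j)"
    by (auto intro: words_of_degree_mono[rotated])
  show ?case
    by (rule exI, rule words_of_degree.ext_eq[OF words_of_degree.add[OF 1]])
      (use words_of_degree_closed[OF add.prems] words_closed[OF add.hyps(1)] words_closed[OF add.hyps(2)] in \<open>simp add: r_distr\<close>)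
next
  case (mult s t)
  obtain m1 where m1: "words_of_degree m1 (\<lambda>j. r j \<otimes> s j)" using mult.IH mult.prems by blast
  obtain m2 where m2: "words_of_degree m2 (\<lambda>j. r j \<otimes> s j \<otimes> t j)" using mult.IH(2)[OF m1] by blast
  show ?case
    by (rule exI, rule words_of_degree.ext_eq[OF m2])
      (use words_of_degree_closed[OF mult.prems] words_closed[OF mult.hyps(1)] words_closed[OF mult.hyps(2)] in \<open>simp add: m_assoc\<close>)
qed

lemma words_degree_exists:
  assumes "s \<in> words"
  shows "\<exists>m. words_of_degree m s"
proof -
  obtain m where m: "words_of_degree m (\<lambda>j. (k 1 \<otimes> x j [^] (0::nat)) \<otimes> s j)"
    using words_of_degree_mult_word[OF assms words_of_degree.pow] by blast
  then show ?thesis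
    by (intro exI, rule words_of_degree.ext_eq) (use words_closed[OF assms] in simp)
qed

definition place_sum :: "(nat \<Rightarrow> 'b) \<Rightarrow> 'b" where
  "place_sum r = (\<Oplus>j\<in>{..<n}. r j)"

text \<open>Expanding the last factor \<open>d j\<close> by interpolation replaces it by powers of \<open>x j\<close> and by
  elements of \<open>L\<close>, so the degree drops.\<close>

lemma L_place_sum_of_degree: "words_of_degree m r \<Longrightarrow> place_sum r \<in> L"
proof (induction m arbitrary: r rule: less_induct)
  case (less m)
  \<comment> \<open>Sums do not lower the degree, so they need an inner induction on the derivation;
    the outer hypothesis is carried along for the case of a final \<open>d\<close>.\<close>
  from less.prems less.IH show ?case
  proof (induction rule: words_of_degree.induct)
    case (pow m c a)
    have "place_sum (\<lambda>j. k c \<otimes> x j [^] a) = k c \<otimes> power_sum a"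
      unfolding place_sum_def power_sum_def by (intro finsum_rdistr[symmetric]) auto
    then show ?case using L_mult L_k L_elem_sym_power_sum by simp
  next
    case (add m r s)
    have "place_sum (\<lambda>j. r j \<oplus> s j) = place_sum r \<oplus> place_sum s"
      unfolding place_sum_def using words_of_degree_closed[OF add.hyps(1)] words_of_degree_closed[OF add.hyps(2)] by (intro finsum_addf) auto
    then show ?case using add.IH add.prems L_add by simp
  next
    case (mult_d m r)
    have rc: "r j \<in> carrier D" if "j < n" for j
      using mult_d.hyps words_of_degree_closed that by blast
    have "place_sum (\<lambda>j. r j \<otimes> d j) = (\<Oplus>j\<in>{..<n}. \<Oplus>i\<in>{..<n}. (r j \<otimes> x j [^] i) \<otimes> b i)"
      unfolding place_sum_def
    proof (rule finsum_cong'[OF refl])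
      fix j assume "j \<in> {..<n}"
      then have j: "j < n" by simp
      have "r j \<otimes> d j = r j \<otimes> peval n (x j) b" using j by (simp add: peval_b)
      also have "\<dots> = (\<Oplus>i\<in>{..<n}. r j \<otimes> (x j [^] i \<otimes> b i))"
        unfolding peval_def using rc j by (intro finsum_rdistr) auto
      also have "\<dots> = (\<Oplus>i\<in>{..<n}. (r j \<otimes> x j [^] i) \<otimes> b i)"
        using rc j by (intro finsum_cong') (auto simp: m_assoc)
      finally show "r j \<otimes> d j = (\<Oplus>i\<in>{..<n}. (r j \<otimes> x j [^] i) \<otimes> b i)" .
    qed (use rc in \<open>auto intro!: finsum_closed\<close>)
    also have "\<dots> = (\<Oplus>i\<in>{..<n}. \<Oplus>j\<in>{..<n}. (r j \<otimes> x j [^] i) \<otimes> b i)"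
      using rc by (intro finsum_swap) auto
    also have "\<dots> = (\<Oplus>i\<in>{..<n}. place_sum (\<lambda>j. r j \<otimes> x j [^] i) \<otimes> b i)"
      unfolding place_sum_def using rc
      by (intro finsum_cong') (auto intro!: finsum_closed finsum_ldistr[symmetric])
    also have "\<dots> \<in> L"
      using mult_d.prems[OF lessI words_of_degree_mult_x_pow[OF mult_d.hyps]] L_b
      by (intro L_finsum L_mult) auto
    finally show ?case .
  next
    case (ext_eq m r s)
    have "place_sum s = place_sum r"
      unfolding place_sum_def using ext_eq.hyps(2) words_of_degree_closed[OF ext_eq.hyps(1)] by (intro finsum_cong') auto
    then show ?case using ext_eq.IH ext_eq.prems by simp
  qed
qed

lemma L_place_sum: "r \<in> words \<Longrightarrow> place_sum r \<in> L"
  using words_degree_exists L_place_sum_of_degree by blast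

lemma words_ad_zero:
  assumes "s \<in> words" "z \<in> carrier D" "j < n" "ad z (x j) = \<zero>" "ad z (d j) = \<zero>"
  shows "ad z (s j) = \<zero>"
  using assms
proof (induction rule: words.induct)
  case (add r s)
  then show ?case using words_closed[OF add.hyps(1)] words_closed[OF add.hyps(2)] by (simp add: ad_add)
next
  case (mult r s)
  then show ?case using words_closed[OF mult.hyps(1)] words_closed[OF mult.hyps(2)] by (simp add: ad_mult)
qed auto

lemma ad_x_d: "i < n \<Longrightarrow> j < n \<Longrightarrow> i \<noteq> j \<Longrightarrow> ad (x i) (d j) = \<zero>"
  using weyl by (simp add: weyl_systemD)

text \<open>Two passes: first the generators at place \<open>i\<close> against the whole word
  \<open>s j\<close>, then \<open>s j\<close> against the whole word \<open>r i\<close>.\<close>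

lemma words_commute:
  assumes "r \<in> words" "s \<in> words" "i < n" "j < n" "i \<noteq> j"
  shows "r i \<otimes> s j = s j \<otimes> r i"
proof -
  have sc: "s j \<in> carrier D" "r i \<in> carrier D" using assms words_closed by auto
  have "ad (x i) (s j) = \<zero>" "ad (d i) (s j) = \<zero>"
    using assms by (intro words_ad_zero[OF assms(2) _ assms(4)]; simp add: ad_x_d ad_d_x)+
  then have "ad (s j) (x i) = \<zero>" "ad (s j) (d i) = \<zero>"
    using sc assms ad_zero_swap[of "x i" "s j"] ad_zero_swap[of "d i" "s j"] by auto
  then have "ad (s j) (r i) = \<zero>"
    using assms(3) sc by (intro words_ad_zero[OF assms(1) _ assms(3)]) auto
  then show ?thesis using sc by (simp add: ad_eq_zero_iff)
qed

text \<open>A list fixes the order of the factors, as the ring is not commutative. Slots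
  \<open>j\<close> are kept apart from places \<open>f j\<close> so that a permutation affects only
  \<open>f\<close>.\<close>

primrec place_prod :: "nat list \<Rightarrow> (nat \<Rightarrow> nat \<Rightarrow> 'b) \<Rightarrow> (nat \<Rightarrow> nat) \<Rightarrow> 'b" where
  "place_prod [] R f = \<one>"
| "place_prod (j # js) R f = R j (f j) \<otimes> place_prod js R f"

lemma place_prod_closed:
  assumes "\<And>j. j \<in> set js \<Longrightarrow> R j \<in> words" "\<And>j. j \<in> set js \<Longrightarrow> f j < n"
  shows "place_prod js R f \<in> carrier D"
  using assms by (induction js) (auto simp: words_closed)

lemma place_prod_cong:
  "(\<And>j. j \<in> set js \<Longrightarrow> R j (f j) = R' j (f' j)) \<Longrightarrow> place_prod js R f = place_prod js R' f'"
  by (induction js) auto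

text \<open>The new factor moves past the earlier ones, which sit at other places because
  \<open>f\<close> is injective, until it meets the factor of slot \<open>s\<close>.\<close>

lemma place_prod_absorb:
  assumes "u \<in> words" "s \<in> set js" "distinct js" "inj_on f (set js)"
    "\<And>j. j \<in> set js \<Longrightarrow> R j \<in> words" "\<And>j. j \<in> set js \<Longrightarrow> f j < n"
  shows "u (f s) \<otimes> place_prod js R f = place_prod js (R(s := \<lambda>i. u i \<otimes> R s i)) f"
  using assms(2-)
proof (induction js)
  case (Cons j js)
  have c: "place_prod js R f \<in> carrier D" "R j (f j) \<in> carrier D" "u (f s) \<in> carrier D"
    using Cons.prems by (auto intro: place_prod_closed words_closed[OF assms(1)] words_closed[of "R j"])
  show ?case
  proof (cases "j = s")
    case True
    have "place_prod js R f = place_prod js (R(s := \<lambda>i. u i \<otimes> R s i)) f"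
      using Cons.prems True by (intro place_prod_cong) auto
    then show ?thesis using True c by (simp add: m_assoc fun_upd_def)
  next
    case False
    then have "s \<in> set js" "f s \<noteq> f j" using Cons.prems by (auto simp: inj_on_def)
    then have 1: "u (f s) \<otimes> R j (f j) = R j (f j) \<otimes> u (f s)"
      using Cons.prems assms(1) by (intro words_commute) auto
    have 2: "u (f s) \<otimes> place_prod js R f = place_prod js (R(s := \<lambda>i. u i \<otimes> R s i)) f"
      using Cons.prems \<open>s \<in> set js\<close> by (intro Cons.IH) (auto simp: inj_on_def)
    have "u (f s) \<otimes> place_prod (j # js) R f = R j (f j) \<otimes> (u (f s) \<otimes> place_prod js R f)"
      using c 1 by (simp add: m_assoc[symmetric])
    then show ?thesis using False 2 by (simp add: fun_upd_def)
  qed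
qed simp

abbreviation Sym :: "(nat \<Rightarrow> nat) set" where
  "Sym \<equiv> {\<sigma>. \<sigma> permutes {..<n}}"

lemma finite_Sym [simp]: "finite Sym"
  by (rule finite_permutations) simp

lemma Sym_less: "\<sigma> \<in> Sym \<Longrightarrow> j < n \<Longrightarrow> \<sigma> j < n"
  using permutes_in_image[of \<sigma> "{..<n}" j] by auto

lemma finsum_Sym_reindex:
  assumes "\<sigma> \<in> Sym" "\<And>j. j < n \<Longrightarrow> r j \<in> carrier D"
  shows "(\<Oplus>j\<in>{..<n}. r (\<sigma> j)) = (\<Oplus>j\<in>{..<n}. r j)"
proof -
  have "(\<Oplus>j\<in>{..<n}. r (\<sigma> j)) = (\<Oplus>j\<in>\<sigma> ` {..<n}. r j)"
    using assms by (intro finsum_reindex[symmetric])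
      (auto simp: permutes_image intro: inj_on_subset[OF permutes_inj])
  then show ?thesis using assms permutes_image by fastforce
qed

definition sym_sum :: "nat list \<Rightarrow> (nat \<Rightarrow> nat \<Rightarrow> 'b) \<Rightarrow> 'b" where
  "sym_sum js R = (\<Oplus>\<sigma>\<in>Sym. place_prod js R \<sigma>)"

text \<open>Polarised power sums generate: multiplying by \<^term>\<open>place_sum (R t)\<close> yields copies of the product
  over \<open>t # js\<close> together with terms in which \<open>R t\<close> was merged into a factor of \<open>js\<close>.\<close>

lemma L_sym_sum:
  assumes "distinct js" "set js \<subseteq> {..<n}" "\<And>j. j \<in> set js \<Longrightarrow> R j \<in> words"
  shows "sym_sum js R \<in> L"
  using assms
proof (induction js arbitrary: R)
  case Nil
  then show ?case by (simp add: sym_sum_def finsum_const_k)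
next
  case (Cons t js)
  have t: "t < n" "t \<notin> set js" "R t \<in> words" and js: "distinct js" "set js \<subseteq> {..<n}"
    and R: "\<And>j. j \<in> set js \<Longrightarrow> R j \<in> words" using Cons.prems by auto
  have pc: "place_prod js R \<sigma> \<in> carrier D" if "\<sigma> \<in> Sym" for \<sigma>
    using R js that Sym_less by (intro place_prod_closed) auto
  have tc: "R t (\<sigma> s) \<in> carrier D" if "\<sigma> \<in> Sym" "s < n" for \<sigma> s
    using words_closed[OF t(3)] that Sym_less by auto
  define T where "T s = (\<Oplus>\<sigma>\<in>Sym. R t (\<sigma> s) \<otimes> place_prod js R \<sigma>)" for s
  have Tc: "T s \<in> carrier D" if "s < n" for s
    unfolding T_def using pc tc that by (intro finsum_closed) auto
  have "place_sum (R t) \<otimes> sym_sum js R = (\<Oplus>\<sigma>\<in>Sym. place_sum (R t) \<otimes> place_prod js R \<sigma>)"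
    unfolding sym_sum_def using pc L_place_sum[OF t(3)] L_closed by (intro finsum_rdistr) auto
  also have "\<dots> = (\<Oplus>\<sigma>\<in>Sym. \<Oplus>s\<in>{..<n}. R t (\<sigma> s) \<otimes> place_prod js R \<sigma>)"
  proof (rule finsum_cong'[OF refl])
    fix \<sigma> assume s: "\<sigma> \<in> Sym"
    \<comment> \<open>A sum over all places is unchanged by \<open>\<sigma>\<close>, so in each
      summand the places may be labelled by slots.\<close>
    have "place_sum (R t) = (\<Oplus>s\<in>{..<n}. R t (\<sigma> s))"
      unfolding place_sum_def using finsum_Sym_reindex[OF s, of "R t"] words_closed[OF t(3)] by simp
    then show "place_sum (R t) \<otimes> place_prod js R \<sigma> = (\<Oplus>s\<in>{..<n}. R t (\<sigma> s) \<otimes> place_prod js R \<sigma>)"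
      using s tc pc by (simp add: finsum_ldistr Pi_def)
  qed (use pc tc in \<open>auto intro!: finsum_closed\<close>)
  also have "\<dots> = (\<Oplus>s\<in>{..<n}. T s)"
    unfolding T_def using pc tc by (intro finsum_swap) auto
  also have "{..<n} = set js \<union> ({..<n} - set js)" using js by auto
  also have "(\<Oplus>s\<in>\<dots>. T s) = (\<Oplus>s\<in>set js. T s) \<oplus> (\<Oplus>s\<in>{..<n} - set js. T s)"
    using Tc js by (intro finsum_Un_disjoint) auto
  finally have eq: "place_sum (R t) \<otimes> sym_sum js R =
      (\<Oplus>s\<in>set js. T s) \<oplus> (\<Oplus>s\<in>{..<n} - set js. T s)" .
  have "T s \<in> L" if "s \<in> set js" for s
  proof -
    have "T s = sym_sum js (R(s := \<lambda>i. R t i \<otimes> R s i))"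
      unfolding T_def sym_sum_def
    proof (rule finsum_cong'[OF refl])
      fix \<sigma> assume s: "\<sigma> \<in> Sym"
      show "R t (\<sigma> s) \<otimes> place_prod js R \<sigma> = place_prod js (R(s := \<lambda>i. R t i \<otimes> R s i)) \<sigma>"
        using t that js R s Sym_less
        by (intro place_prod_absorb) (auto intro: inj_on_subset[OF permutes_inj])
    next
      show "place_prod js (R(s := \<lambda>i. R t i \<otimes> R s i)) \<in> Sym \<rightarrow> carrier D"
        using t R js that Sym_less by (intro funcsetI place_prod_closed) (auto intro: words.mult)
    qed
    also have "\<dots> \<in> L"
      using t R js that by (intro Cons.IH) (auto intro: words.mult)
    finally show ?thesis .
  qed
  then have 1: "(\<Oplus>s\<in>set js. T s) \<in> L" by (rule L_finsum)
  \<comment> \<open>The transposition of \<open>s\<close> and \<open>t\<close> fixes every slot of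
    \<open>js\<close>; composing the permutations with it moves the factor \<open>R t\<close> from
    slot \<open>s\<close> to slot \<open>t\<close>.\<close>
  have T_eq: "T s = sym_sum (t # js) R" if s: "s < n" "s \<notin> set js" for s
  proof -
    define \<tau> where "\<tau> = transpose s t"
    have \<tau>: "\<tau> permutes {..<n}" unfolding \<tau>_def using s t by (intro permutes_swap_id) auto
    have fixed: "\<tau> j = j" if "j \<in> set js" for j
      using that s t unfolding \<tau>_def by (metis transpose_apply_other)
    have im: "(\<lambda>\<sigma>. \<sigma> \<circ> \<tau>) ` Sym = Sym"
      using image_compose_permutations_right[OF \<tau>] by (simp add: image_Collect)
    have inj: "inj_on (\<lambda>\<sigma>. \<sigma> \<circ> \<tau>) Sym"
      using permutes_bij[OF \<tau>] by (intro inj_onI) (metis bij_is_surj fun.inj_map_strong o_inv_o_cancel surj_iff comp_assoc comp_id)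
    have "sym_sum (t # js) R = (\<Oplus>\<sigma>\<in>(\<lambda>\<sigma>. \<sigma> \<circ> \<tau>) ` Sym. R t (\<sigma> t) \<otimes> place_prod js R \<sigma>)"
      unfolding im sym_sum_def
      by (rule arg_cong[where f = "\<lambda>h. finsum D h Sym"]) (simp add: fun_eq_iff)
    also have "\<dots> = (\<Oplus>\<sigma>\<in>Sym. R t ((\<sigma> \<circ> \<tau>) t) \<otimes> place_prod js R (\<sigma> \<circ> \<tau>))"
      using im pc tc t by (intro finsum_reindex inj) auto
    also have "\<dots> = T s"
      unfolding T_def
    proof (rule finsum_cong'[OF refl])
      fix \<sigma>
      have "place_prod js R (\<sigma> \<circ> \<tau>) = place_prod js R \<sigma>"
        by (rule place_prod_cong) (simp add: fixed)
      then show "R t ((\<sigma> \<circ> \<tau>) t) \<otimes> place_prod js R (\<sigma> \<circ> \<tau>) = R t (\<sigma> s) \<otimes> place_prod js R \<sigma>"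
        by (simp add: \<tau>_def)
    qed (use pc tc s in auto)
    finally show ?thesis by simp
  qed
  \<comment> \<open>The slots outside \<open>js\<close> all contribute the same summand. Slot
    \<open>t\<close> is one of them, so \<open>N\<close> is nonzero and can be divided by.\<close>
  define N where "N = card ({..<n} - set js)"
  have "N \<noteq> 0" using t unfolding N_def by auto
  have sc: "sym_sum (t # js) R \<in> carrier D" using T_eq[OF t(1,2)] Tc[OF t(1)] by simp
  have "(\<Oplus>s\<in>{..<n} - set js. T s) = (\<Oplus>s\<in>{..<n} - set js. sym_sum (t # js) R)"
    using T_eq sc by (intro finsum_cong') auto
  also have "\<dots> = k (of_nat N) \<otimes> sym_sum (t # js) R"
    unfolding N_def using sc by (intro finsum_const_k) auto
  finally have 2: "place_sum (R t) \<otimes> sym_sum js R \<ominus> k (of_nat N) \<otimes> sym_sum (t # js) R = (\<Oplus>s\<in>set js. T s)"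
    unfolding eq using L_closed[OF 1] sc by (simp add: minus_eq a_assoc r_neg)
  have 3: "place_sum (R t) \<otimes> sym_sum js R \<in> L"
    using L_place_sum t Cons.IH js R by (intro L_mult) auto
  have "k (of_nat N) \<otimes> sym_sum (t # js) R \<in> L"
    using L_diff_iff[OF 3, of "k (of_nat N) \<otimes> sym_sum (t # js) R"] 1 2 sc by simp
  then show ?case using L_k_mult_iff[of "of_nat N"] \<open>N \<noteq> 0\<close> sc by simp
qed

section \<open>The symmetric group action\<close>

lemma weyl_system_permute:
  assumes "\<sigma> \<in> Sym"
  shows "weyl_system n (\<lambda>i. x (\<sigma> i)) (\<lambda>i. d (\<sigma> i))"
proof -
  have "inj \<sigma>" using assms permutes_inj by auto
  then show ?thesis
    using Sym_less[OF assms] by (simp add: weyl_system_def ad_d_x inj_eq)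
qed

definition act :: "(nat \<Rightarrow> nat) \<Rightarrow> 'b \<Rightarrow> 'b" where
  "act \<sigma> = (SOME h. h \<in> ring_hom D D \<and> (\<forall>c. h (k c) = k c) \<and>
     (\<forall>i<n. h (x i) = x (\<sigma> i) \<and> h (d i) = d (\<sigma> i)))"

lemma act:
  assumes "\<sigma> \<in> Sym"
  shows act_hom: "act \<sigma> \<in> ring_hom D D"
    and act_k: "act \<sigma> (k c) = k c"
    and act_x: "i < n \<Longrightarrow> act \<sigma> (x i) = x (\<sigma> i)"
    and act_d: "i < n \<Longrightarrow> act \<sigma> (d i) = d (\<sigma> i)"
proof -
  have "\<exists>h. h \<in> ring_hom D D \<and> (\<forall>c. h (k c) = k c) \<and>
      (\<forall>i<n. h (x i) = x (\<sigma> i) \<and> h (d i) = d (\<sigma> i))"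
    using weyl_hom_exists[OF weyl weyl_system_permute[OF assms] frac] by blast
  then have "act \<sigma> \<in> ring_hom D D \<and> (\<forall>c. act \<sigma> (k c) = k c) \<and>
      (\<forall>i<n. act \<sigma> (x i) = x (\<sigma> i) \<and> act \<sigma> (d i) = d (\<sigma> i))"
    unfolding act_def by (rule someI_ex)
  then show "act \<sigma> \<in> ring_hom D D" "act \<sigma> (k c) = k c"
    "i < n \<Longrightarrow> act \<sigma> (x i) = x (\<sigma> i)" "i < n \<Longrightarrow> act \<sigma> (d i) = d (\<sigma> i)" by auto
qed

lemmas act_closed [simp] = ring_hom_closed[OF act_hom]

definition invariants :: "'b set" where
  "invariants = {z \<in> carrier D. \<forall>\<sigma>\<in>Sym. act \<sigma> z = z}"

lemma L_subset_invariants: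
  assumes "z \<in> L"
  shows "z \<in> invariants"
proof -
  obtain w where w: "w \<in> carrier D" "z = Phi w" using assms by (auto simp: L_def)
  have "act \<sigma> (Phi w) = Phi w" if \<sigma>: "\<sigma> \<in> Sym" for \<sigma>
  proof -
    have y: "act \<sigma> (y i) = y i" if "i < n" for i
    proof -
      have "act \<sigma> (power_sum a) = power_sum a" for a
      proof -
        have "act \<sigma> (power_sum a) = (\<Oplus>j\<in>{..<n}. act \<sigma> (x j [^] a))"
          unfolding power_sum_def by (rule ring_hom_finsum[OF act_hom[OF \<sigma>]]) auto
        also have "\<dots> = (\<Oplus>j\<in>{..<n}. x (\<sigma> j) [^] a)"
          using Sym_less[OF \<sigma>] \<sigma>
          by (intro finsum_cong') (auto simp: ring_hom_pow[OF act_hom] act_x)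
        also have "\<dots> = power_sum a"
          unfolding power_sum_def using finsum_Sym_reindex[OF \<sigma>, of "\<lambda>j. x j [^] a"] by simp
        finally show ?thesis .
      qed
      then show ?thesis
        using ring_hom_mult[OF act_hom[OF \<sigma>], of "k (inverse (of_nat (Suc i)))" "power_sum (Suc i)"] \<sigma>
        by (simp add: y_def act_k)
    qed
    have b: "act \<sigma> (b i) = b i" if i: "i < n" for i
    proof (rule vandermonde_unique[OF x_commuting_distinct _ _ _ i, of "\<lambda>i. act \<sigma> (b i)" b])
      fix j assume j: "j < n"
      \<comment> \<open>The automorphism carries the interpolation condition at \<open>x l\<close>
        to the one at \<open>x j\<close>, so the images of the \<open>b i\<close> solve the same
        system.\<close>
      then obtain l where l: "l < n" "j = \<sigma> l"
        using \<sigma> permutes_image[of \<sigma> "{..<n}"] by (auto simp: image_iff set_eq_iff)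
      have "peval n (x j) (\<lambda>i. act \<sigma> (b i)) = (\<Oplus>i\<in>{..<n}. act \<sigma> (x l [^] i \<otimes> b i))"
        unfolding peval_def using l \<sigma> j
        by (intro finsum_cong')
          (auto simp: ring_hom_mult[OF act_hom] ring_hom_pow[OF act_hom] act_x)
      also have "\<dots> = act \<sigma> (peval n (x l) b)"
        unfolding peval_def using l by (intro ring_hom_finsum[OF act_hom[OF \<sigma>], symmetric]) auto
      also have "\<dots> = peval n (x j) b"
        using l j \<sigma> by (simp add: peval_b act_d)
      finally show "peval n (x j) (\<lambda>i. act \<sigma> (b i)) = peval n (x j) b" .
    qed (use \<sigma> in auto)
    have "(act \<sigma> \<circ> Phi) w = Phi w"
    proof (rule weyl_hom_unique[OF weyl frac _ Phi_hom _ _ _ w(1)])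
      show "act \<sigma> \<circ> Phi \<in> ring_hom D D"
        using ring_hom_trans[OF Phi_hom act_hom[OF \<sigma>]] .
    qed (use \<sigma> y b act_k in auto)
    then show ?thesis by simp
  qed
  then show ?thesis using w ring_hom_closed[OF Phi_hom] by (auto simp: invariants_def)
qed

lemma act_word:
  assumes "\<sigma> \<in> Sym" "r \<in> words" "j < n"
  shows "act \<sigma> (r j) = r (\<sigma> j)"
  using assms(2)
proof (induction rule: words.induct)
  case (add r s)
  then show ?case
    using ring_hom_add[OF act_hom[OF assms(1)] words_closed[OF add.hyps(1) assms(3)]
        words_closed[OF add.hyps(2) assms(3)]] by simp
next
  case (mult r s)
  then show ?case
    using ring_hom_mult[OF act_hom[OF assms(1)] words_closed[OF mult.hyps(1) assms(3)]
        words_closed[OF mult.hyps(2) assms(3)]] by simp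
qed (use assms in \<open>auto simp: act_k act_x act_d\<close>)

lemma act_place_prod:
  assumes "\<sigma> \<in> Sym" "\<And>j. j \<in> set js \<Longrightarrow> R j \<in> words" "\<And>j. j \<in> set js \<Longrightarrow> j < n"
  shows "act \<sigma> (place_prod js R id) = place_prod js R \<sigma>"
  using assms(2,3)
proof (induction js)
  case Nil
  then show ?case using ring_hom_one[OF act_hom[OF assms(1)]] by simp
next
  case (Cons j js)
  have "place_prod js R id \<in> carrier D" "R j j \<in> carrier D"
    using Cons.prems by (auto intro!: place_prod_closed words_closed[of "R j"])
  from ring_hom_mult[OF act_hom[OF assms(1)] this(2,1)] show ?case
    using Cons act_word[OF assms(1), of "R j" j] by (simp add: id_def)
qed

text \<open>Mirrors A_n as the \<open>n\<close>-fold tensor power of the first Weyl algebra: one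
  word for each place, and sums of such products.\<close>

inductive_set span_prods :: "'b set" where
  prod: "(\<And>j. j < n \<Longrightarrow> R j \<in> words) \<Longrightarrow> place_prod [0..<n] R id \<in> span_prods"
| sum: "p \<in> span_prods \<Longrightarrow> q \<in> span_prods \<Longrightarrow> p \<oplus> q \<in> span_prods"

lemma span_prods_closed: "p \<in> span_prods \<Longrightarrow> p \<in> carrier D"
proof (induction rule: span_prods.induct)
  case (prod R)
  then show ?case by (intro place_prod_closed) auto
qed auto

lemma span_prods_word:
  assumes "u \<in> words" "i < n" "p \<in> span_prods"
  shows "u i \<otimes> p \<in> span_prods"
  using assms(3)
proof (induction rule: span_prods.induct)
  case (prod R)
  have "u (id i) \<otimes> place_prod [0..<n] R id = place_prod [0..<n] (R(i := \<lambda>j. u j \<otimes> R i j)) id"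
    using assms prod by (intro place_prod_absorb) auto
  also have "\<dots> \<in> span_prods"
    using assms prod by (intro span_prods.prod) (auto intro: words.mult)
  finally show ?case by simp
next
  case (sum p q)
  then show ?case
    using words_closed[OF assms(1,2)] span_prods_closed
    by (simp add: r_distr span_prods.sum)
qed

lemma gen_alg_mult_span_prods:
  assumes "p \<in> gen_alg n x d"
  shows "q \<in> span_prods \<Longrightarrow> p \<otimes> q \<in> span_prods"
  using assms
proof (induction arbitrary: q rule: gen_alg.induct)
  case (scalar c)
  \<comment> \<open>A scalar is merged into the word at place 0, which exists because
    \<open>n\<close> is positive.\<close>
  then show ?case using span_prods_word[OF words.scalar n_pos] by blast
next
  case (gen_x i)
  then show ?case using span_prods_word[OF words.gen_x] by blast
next
  case (gen_d i)
  then show ?case using span_prods_word[OF words.gen_d] by blast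
next
  case (add p r)
  then show ?case
    using gen_alg_closed[OF weyl] span_prods_closed by (simp add: l_distr span_prods.sum)
next
  case (mult p r)
  then show ?case
    using gen_alg_closed[OF weyl] span_prods_closed by (simp add: m_assoc)
qed

lemma gen_alg_span_prods:
  assumes "p \<in> gen_alg n x d"
  shows "p \<in> span_prods"
proof -
  have "place_prod js (\<lambda>_ _. \<one>) id = \<one>" for js by (induction js) auto
  moreover have "(\<lambda>_. \<one>) \<in> words" using words.scalar[of 1] by simp
  ultimately have "\<one> \<in> span_prods" using span_prods.prod[of "\<lambda>_ _. \<one>"] by simp
  from gen_alg_mult_span_prods[OF assms this] show ?thesis
    using gen_alg_closed[OF weyl assms] by simp
qed

section \<open>Traces over the symmetric group\<close>

definition trace :: "'b \<Rightarrow> 'b" where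
  "trace p = (\<Oplus>\<sigma>\<in>Sym. act \<sigma> p)"

text \<open>The group moves only the places of the words, so the trace of a product of words is a
  \<open>sym_sum\<close> over all slots.\<close>

lemma L_trace:
  assumes "p \<in> gen_alg n x d"
  shows "trace p \<in> L"
  using gen_alg_span_prods[OF assms]
proof (induction rule: span_prods.induct)
  case (prod R)
  have "trace (place_prod [0..<n] R id) = sym_sum [0..<n] R"
    unfolding trace_def sym_sum_def
    using prod Sym_less by (intro finsum_cong') (auto intro!: place_prod_closed act_place_prod)
  also have "\<dots> \<in> L" using prod by (intro L_sym_sum) auto
  finally show ?case .
next
  case (sum p q)
  have c: "p \<in> carrier D" "q \<in> carrier D" using sum span_prods_closed by auto
  have "trace (p \<oplus> q) = (\<Oplus>\<sigma>\<in>Sym. act \<sigma> p \<oplus> act \<sigma> q)"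
    unfolding trace_def using c by (intro finsum_cong') (auto simp: ring_hom_add[OF act_hom])
  also have "\<dots> = trace p \<oplus> trace q"
    unfolding trace_def using c by (intro finsum_addf) auto
  finally show ?case using sum L_add by simp
qed

text \<open>A linear form with the distinct weights 1, ..., \<open>n\<close>. Its images under
  different permutations differ, yet commute as combinations of the \<open>x j\<close>; they are the
  nodes of a Vandermonde argument indexed by the group.\<close>

definition separator :: 'b where
  "separator = (\<Oplus>j\<in>{..<n}. k (of_nat (Suc j)) \<otimes> x j)"

lemma separator_gen_alg: "separator [^] (m::nat) \<in> gen_alg n x d"
proof -
  have "(\<Oplus>j\<in>{..<l}. k (of_nat (Suc j)) \<otimes> x j) \<in> gen_alg n x d" if "l \<le> n" for l
    using that
  proof (induction l)
    case 0
    then show ?case using gen_alg.scalar[of 0 n x d] by simp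
  next
    case (Suc l)
    then show ?case
      unfolding lessThan_Suc
      by (subst finsum_insert) (auto intro!: gen_alg.intros simp del: of_nat_Suc)
  qed
  then have "separator \<in> gen_alg n x d" unfolding separator_def by simp
  then show ?thesis
    by (induction m) (use gen_alg.scalar[of 1 n x d] in \<open>auto intro: gen_alg.mult\<close>)
qed

lemma separator_closed [simp]: "separator \<in> carrier D"
  unfolding separator_def by (intro finsum_closed) auto

lemma act_separator:
  assumes "\<sigma> \<in> Sym"
  shows "act \<sigma> separator = (\<Oplus>j\<in>{..<n}. k (of_nat (Suc j)) \<otimes> x (\<sigma> j))"
proof -
  have "act \<sigma> separator = (\<Oplus>j\<in>{..<n}. act \<sigma> (k (of_nat (Suc j)) \<otimes> x j))"
    unfolding separator_def by (rule ring_hom_finsum[OF act_hom[OF assms]]) auto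
  also have "\<dots> = (\<Oplus>j\<in>{..<n}. k (of_nat (Suc j)) \<otimes> x (\<sigma> j))"
    using assms Sym_less[OF assms]
    by (intro finsum_cong') (auto simp: ring_hom_mult[OF act_hom] act_k act_x simp del: of_nat_Suc)
  finally show ?thesis .
qed

lemma separator_commuting_distinct: "commuting_distinct Sym (\<lambda>\<sigma>. act \<sigma> separator)"
proof -
  have comm: "act \<sigma> separator \<otimes> act \<tau> separator = act \<tau> separator \<otimes> act \<sigma> separator"
    if s: "\<sigma> \<in> Sym" "\<tau> \<in> Sym" for \<sigma> \<tau>
  proof -
    have 1: "ad (x i) (act \<rho> separator) = \<zero>" if "i < n" "\<rho> \<in> Sym" for i \<rho>
      unfolding act_separator[OF that(2)] using that Sym_less[OF that(2)]
      by (subst ad_finsum) (auto intro!: add.finprod_one_eqI simp: ad_k_mult simp del: of_nat_Suc)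
    have 2: "ad (act \<rho> separator) (x i) = \<zero>" if "i < n" "\<rho> \<in> Sym" for i \<rho>
      using 1[OF that] that by (intro ad_zero_swap[of "x i"]) auto
    have "ad (act \<sigma> separator) (act \<tau> separator) = \<zero>"
      unfolding act_separator[OF s(2)] using s Sym_less 2
      by (subst ad_finsum) (auto intro!: add.finprod_one_eqI simp: ad_k_mult simp del: of_nat_Suc)
    then show ?thesis using s by (simp add: ad_eq_zero_iff)
  qed
  have "inj_on (\<lambda>\<sigma>. act \<sigma> separator) Sym"
  proof (rule inj_onI)
    fix \<sigma> \<tau> assume s: "\<sigma> \<in> Sym" "\<tau> \<in> Sym" and eq: "act \<sigma> separator = act \<tau> separator"
    \<comment> \<open>Commutators with the \<open>d\<close> read off the weights: the weight
      \<open>Suc i\<close> is found at place \<open>\<rho> i\<close>, which recovers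
      \<open>\<rho>\<close> from the image.\<close>
    have val: "ad (d (\<rho> i)) (act \<rho> separator) = k (of_nat (Suc i))" if "\<rho> \<in> Sym" "i < n" for \<rho> i
    proof -
      have inj: "inj \<rho>" using that permutes_inj by auto
      have "ad (d (\<rho> i)) (act \<rho> separator) = (\<Oplus>j\<in>{..<n}. ad (d (\<rho> i)) (k (of_nat (Suc j)) \<otimes> x (\<rho> j)))"
        unfolding act_separator[OF that(1)] using that Sym_less[OF that(1)] by (intro ad_finsum) auto
      also have "\<dots> = (\<Oplus>j\<in>{..<n}. if i = j then k (of_nat (Suc j)) else \<zero>)"
        using that Sym_less[OF that(1)] inj
        by (intro finsum_cong') (auto simp: ad_k_mult ad_d_x inj_eq simp del: of_nat_Suc)
      also have "\<dots> = k (of_nat (Suc i))"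
        using that by (intro add.finprod_singleton) auto
      finally show ?thesis .
    qed
    have "\<sigma> i = \<tau> i" if i: "i < n" for i
    proof -
      obtain l where l: "l < n" "\<sigma> i = \<tau> l"
        using s permutes_image[of \<tau> "{..<n}"] Sym_less[OF s(1) i] by (auto simp: image_iff set_eq_iff)
      have "k (of_nat (Suc i)) = k (of_nat (Suc l))"
        using val[OF s(1) i] val[OF s(2) l(1)] l(2) eq by simp
      then have "i = l" by (simp only: k_eq_iff of_nat_eq_iff nat.inject)
      then show ?thesis using l by simp
    qed
    moreover have "\<sigma> i = \<tau> i" if "\<not> i < n" for i
      using s that by (simp add: permutes_def)
    ultimately show "\<sigma> = \<tau>" by blast
  qed
  then show ?thesis using comm by (simp add: commuting_distinct_def)
qed

text \<open>These traces are the power sums of the images of \<open>separator\<close> with weights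
  \<open>act \<sigma> q\<close>. If all vanished, so would every weight, whereas a ring endomorphism
  of \<open>D\<close> cannot kill \<open>q\<close>.\<close>

lemma trace_nonzero_exists:
  assumes "q \<in> carrier D" "q \<noteq> \<zero>"
  shows "\<exists>m::nat. trace (q \<otimes> separator [^] m) \<noteq> \<zero>"
proof (rule ccontr)
  assume "\<not> ?thesis"
  moreover have "trace (q \<otimes> separator [^] m) = (\<Oplus>\<sigma>\<in>Sym. act \<sigma> q \<otimes> act \<sigma> separator [^] m)" for m :: nat
    unfolding trace_def using assms
    by (intro finsum_cong') (auto simp: ring_hom_mult[OF act_hom] ring_hom_pow[OF act_hom])
  ultimately have "(\<Oplus>\<sigma>\<in>Sym. act \<sigma> q \<otimes> act \<sigma> separator [^] m) = \<zero>" for m :: nat by simp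
  from power_sums_weights_zero[OF finite_Sym separator_commuting_distinct _ this]
  have "act \<sigma> q = \<zero>" if "\<sigma> \<in> Sym" for \<sigma> using that assms by simp
  moreover have "id \<in> Sym" by (simp add: permutes_id)
  ultimately show False using ring_hom_nonzero[OF act_hom] assms by blast
qed

text \<open>The right ideal \<open>{w. z \<otimes> w \<in> A}\<close> of \<open>A\<close>, where \<open>A\<close> is \<^term>\<open>gen_alg n x d\<close>, is stable under the
  group because \<open>z\<close> is invariant, so it contains a nonzero trace.\<close>

lemma invariants_subset_L:
  assumes "z \<in> invariants"
  shows "z \<in> L"
proof -
  have z: "z \<in> carrier D" "\<And>\<sigma>. \<sigma> \<in> Sym \<Longrightarrow> act \<sigma> z = z"
    using assms by (auto simp: invariants_def)
  obtain q where q: "q \<in> gen_alg n x d" "q \<noteq> \<zero>" "z \<otimes> q \<in> gen_alg n x d"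
    using frac z unfolding fractions_def by blast
  have qc: "q \<in> carrier D" using q gen_alg_closed[OF weyl] by blast
  obtain m :: nat where m: "trace (q \<otimes> separator [^] m) \<noteq> \<zero>"
    using trace_nonzero_exists[OF qc q(2)] by blast
  define s where "s = trace (q \<otimes> separator [^] m)"
  have s: "s \<in> L" "s \<noteq> \<zero>" unfolding s_def using q separator_gen_alg m by (auto intro!: L_trace gen_alg.mult)
  have "z \<otimes> s = (\<Oplus>\<sigma>\<in>Sym. z \<otimes> act \<sigma> (q \<otimes> separator [^] m))"
    unfolding s_def trace_def using z qc by (intro finsum_rdistr) auto
  also have "\<dots> = trace (z \<otimes> q \<otimes> separator [^] m)"
    unfolding trace_def using z qc
    by (intro finsum_cong') (auto simp: ring_hom_mult[OF act_hom] m_assoc)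
  also have "\<dots> \<in> L" by (rule L_trace[OF gen_alg.mult[OF q(3) separator_gen_alg]])
  finally have "z \<otimes> s \<in> L" .
  then have "z \<otimes> s \<otimes> inv s \<in> L" using s L_inv L_mult by blast
  moreover have "z \<otimes> s \<otimes> inv s = z"
    using z s L_closed[OF s(1)] units[of s] by (simp add: m_assoc)
  ultimately show ?thesis by simp
qed

lemma invariants_eq_L: "invariants = L"
  using invariants_subset_L L_subset_invariants by blast

section \<open>The theorem\<close>

lemma Phi_inj: "inj_on Phi (carrier D)"
proof (rule inj_onI)
  fix z w assume zw: "z \<in> carrier D" "w \<in> carrier D" "Phi z = Phi w"
  have "Phi (z \<oplus> k (- 1) \<otimes> w) = Phi z \<oplus> k (- 1) \<otimes> Phi w"
    using zw ring_hom_add[OF Phi_hom, of z "k (- 1) \<otimes> w"] ring_hom_mult[OF Phi_hom, of "k (- 1)" w]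
    by simp
  then have "Phi (z \<ominus> w) = \<zero>"
    using zw ring_hom_closed[OF Phi_hom, of w] by (simp add: k_uminus l_minus minus_eq r_neg)
  then show "z = w"
    using ring_hom_nonzero[OF Phi_hom, of "z \<ominus> w"] zw diff_eq_zero_iff by auto
qed

lemma invariants_iso:
  "\<exists>\<phi>\<in>ring_iso (D\<lparr>carrier := invariants\<rparr>) D. \<forall>c. \<phi> (k c) = k c"
proof
  define \<phi> where "\<phi> = inv_into (carrier D) Phi"
  have bij: "bij_betw Phi (carrier D) L"
    using Phi_inj by (auto simp: bij_betw_def L_def)
  have Phi_\<phi>: "Phi (\<phi> z) = z" "\<phi> z \<in> carrier D" if "z \<in> L" for z
    using that unfolding \<phi>_def L_def by (auto intro: f_inv_into_f inv_into_into)
  have \<phi>I: "\<phi> z = w" if "w \<in> carrier D" "Phi w = z" for z w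
    using that Phi_inj unfolding \<phi>_def by (metis inv_into_f_f)
  have "\<phi> \<in> ring_hom (D\<lparr>carrier := L\<rparr>) D"
  proof (rule ring_hom_memI)
    fix z w assume "z \<in> carrier (D\<lparr>carrier := L\<rparr>)" "w \<in> carrier (D\<lparr>carrier := L\<rparr>)"
    then have zw: "z \<in> L" "w \<in> L" by auto
    show "\<phi> (z \<otimes>\<^bsub>D\<lparr>carrier := L\<rparr>\<^esub> w) = \<phi> z \<otimes> \<phi> w" "\<phi> (z \<oplus>\<^bsub>D\<lparr>carrier := L\<rparr>\<^esub> w) = \<phi> z \<oplus> \<phi> w"
      using Phi_\<phi>[OF zw(1)] Phi_\<phi>[OF zw(2)]
      by (auto intro!: \<phi>I simp: ring_hom_mult[OF Phi_hom] ring_hom_add[OF Phi_hom])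
  qed (auto intro!: \<phi>I Phi_\<phi> simp: ring_hom_one[OF Phi_hom])
  moreover have "bij_betw \<phi> L (carrier D)"
    unfolding \<phi>_def by (rule bij_betw_inv_into[OF bij])
  ultimately show "\<phi> \<in> ring_iso (D\<lparr>carrier := invariants\<rparr>) D"
    by (simp add: ring_iso_def invariants_eq_L)
  show "\<forall>c. \<phi> (k c) = k c" by (auto intro: \<phi>I)
qed

end

section \<open>The operator model and its image in the skew field of fractions\<close>

lemma scal_op_1: "scal_op 1 = id"
  by (auto simp: fun_eq_iff scal_op_def)

lemma scal_op_commute:
  "S \<in> weyl_ops n \<Longrightarrow> scal_op c \<circ> S = S \<circ> scal_op c"
proof (induction rule: weyl_ops.induct)
  case (add S T)
  then show ?case by (auto simp: fun_eq_iff scal_op_def add_op_def algebra_simps)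
next
  case (comp S T)
  then show ?case by (metis comp_assoc)
qed (auto simp: fun_eq_iff scal_op_def mulX_def pderivD_def)

lemma mulX_commute: "mulX i \<circ> mulX j = mulX j \<circ> (mulX i :: 'a::field op)"
  by (auto simp: fun_eq_iff mulX_def fun_upd_twist)

lemma pderivD_commute: "pderivD i \<circ> pderivD j = pderivD j \<circ> (pderivD i :: 'a::field op)"
  by (cases "i = j") (auto simp: fun_eq_iff pderivD_def fun_upd_twist)

lemma pderivD_mulX:
  "pderivD i \<circ> mulX j = add_op (mulX j \<circ> pderivD i) (if i = j then id else scal_op 0 :: 'a::field op)"
proof (cases "i = j")
  case True
  \<comment> \<open>The relation read on the coefficient at \<open>\<alpha>\<close>; exponent zero
    is a case of its own because \<open>mulX\<close> returns 0 there.\<close>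
  have "of_nat (\<alpha> j + 1) * f \<alpha> =
      (if 0 < \<alpha> j then of_nat (\<alpha> j - 1 + 1) * f \<alpha> else 0) + f \<alpha>" for \<alpha> and f :: "'a series"
    by (cases "\<alpha> j") (auto simp: algebra_simps)
  then show ?thesis
    using True by (auto simp: fun_eq_iff pderivD_def mulX_def add_op_def)
next
  case False
  then show ?thesis
    by (auto simp: fun_eq_iff pderivD_def mulX_def add_op_def scal_op_def fun_upd_twist)
qed

locale weyl_fractions =
  fixes n :: nat and D (structure) and \<iota> :: "'k::field_char_0 op \<Rightarrow> 'b"
  assumes n_pos: "1 \<le> n" and fractions: "skew_field_of_fractions (weyl_algebra n) D \<iota>"
begin

lemma ring_D: "ring D" and nontrivial_D: "\<one> \<noteq> \<zero>"
  and units_D: "a \<in> carrier D \<Longrightarrow> a \<noteq> \<zero> \<Longrightarrow> a \<in> Units D"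
  using fractions by (auto simp: skew_field_of_fractions_def division_ring_def)

lemma hom: "\<iota> \<in> ring_hom (weyl_algebra n) D"
  using fractions by (auto simp: skew_field_of_fractions_def)

lemma \<iota>_closed: "S \<in> weyl_ops n \<Longrightarrow> \<iota> S \<in> carrier D"
  using ring_hom_closed[OF hom, of S] by (simp add: weyl_algebra_def)

lemma \<iota>_comp: "S \<in> weyl_ops n \<Longrightarrow> T \<in> weyl_ops n \<Longrightarrow> \<iota> (S \<circ> T) = \<iota> S \<otimes> \<iota> T"
  using ring_hom_mult[OF hom, of S T] by (simp add: weyl_algebra_def)

lemma \<iota>_add: "S \<in> weyl_ops n \<Longrightarrow> T \<in> weyl_ops n \<Longrightarrow> \<iota> (add_op S T) = \<iota> S \<oplus> \<iota> T"
  using ring_hom_add[OF hom, of S T] by (simp add: weyl_algebra_def)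

lemma \<iota>_id: "\<iota> id = \<one>"
  using ring_hom_one[OF hom] by (simp add: weyl_algebra_def)

lemma fraction_exists:
  assumes "z \<in> carrier D"
  shows "\<exists>T\<in>weyl_ops n. \<iota> T \<noteq> \<zero> \<and> (\<exists>S\<in>weyl_ops n. z \<otimes> \<iota> T = \<iota> S)"
proof -
  interpret ring D by (rule ring_D)
  obtain S T where "S \<in> weyl_ops n" "T \<in> weyl_ops n" "\<iota> T \<noteq> \<zero>" "z = \<iota> S \<otimes> inv (\<iota> T)"
    using fractions assms by (auto simp: skew_field_of_fractions_def weyl_algebra_def)
  moreover from this have "\<iota> S \<otimes> inv (\<iota> T) \<otimes> \<iota> T = \<iota> S"
    using \<iota>_closed units_D by (simp add: m_assoc)
  ultimately show ?thesis by blast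
qed

text \<open>Scalars visibly commute with the operators; clearing the denominator
  \<open>\<iota> T\<close> extends this to fractions.\<close>

lemma scalar_central:
  assumes "z \<in> carrier D"
  shows "\<iota> (scal_op c) \<otimes> z = z \<otimes> \<iota> (scal_op c)"
proof -
  interpret ring D by (rule ring_D)
  obtain S T where ST: "S \<in> weyl_ops n" "T \<in> weyl_ops n" "\<iota> T \<noteq> \<zero>" "z \<otimes> \<iota> T = \<iota> S"
    using fraction_exists[OF assms] by blast
  have comm: "\<iota> (scal_op c) \<otimes> \<iota> U = \<iota> U \<otimes> \<iota> (scal_op c)" if "U \<in> weyl_ops n" for U
    using that scal_op_commute[OF that] by (metis \<iota>_comp weyl_ops.scal)
  have c: "\<iota> (scal_op c) \<in> carrier D" "\<iota> S \<in> carrier D" "\<iota> T \<in> carrier D"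
    using ST \<iota>_closed weyl_ops.scal by auto
  have u: "\<iota> T \<in> Units D" using c ST units_D by blast
  have "\<iota> (scal_op c) \<otimes> z \<otimes> \<iota> T = z \<otimes> \<iota> (scal_op c) \<otimes> \<iota> T"
    using c assms ST comm[OF ST(1)] comm[OF ST(2)] by (simp add: m_assoc) (simp add: m_assoc[symmetric])
  then have "\<iota> (scal_op c) \<otimes> z \<otimes> \<iota> T \<otimes> inv (\<iota> T) = z \<otimes> \<iota> (scal_op c) \<otimes> \<iota> T \<otimes> inv (\<iota> T)"
    by simp
  then show ?thesis using u c assms by (simp add: m_assoc)
qed

sublocale skew_alg D "\<lambda>c. \<iota> (scal_op c)"
proof (intro skew_alg.intro skew_alg_axioms.intro ring_D nontrivial_D units_D scalar_central)
  fix c c' :: 'k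
  show "\<iota> (scal_op c) \<in> carrier D" by (intro \<iota>_closed weyl_ops.scal)
  have "scal_op (c + c') = add_op (scal_op c) (scal_op c')"
    by (auto simp: fun_eq_iff scal_op_def add_op_def algebra_simps)
  then show "\<iota> (scal_op (c + c')) = \<iota> (scal_op c) \<oplus> \<iota> (scal_op c')"
    by (simp add: \<iota>_add weyl_ops.scal)
  have "scal_op (c * c') = scal_op c \<circ> scal_op c'"
    by (auto simp: fun_eq_iff scal_op_def)
  then show "\<iota> (scal_op (c * c')) = \<iota> (scal_op c) \<otimes> \<iota> (scal_op c')"
    by (simp add: \<iota>_comp weyl_ops.scal)
  show "\<iota> (scal_op 1) = \<one>" by (simp add: scal_op_1 \<iota>_id)
qed

lemma weyl_system_\<iota>: "weyl_system n (\<lambda>i. \<iota> (mulX i)) (\<lambda>i. \<iota> (pderivD i))"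
proof -
  have c: "\<iota> (mulX i) \<in> carrier D" "\<iota> (pderivD i) \<in> carrier D" if "i < n" for i
    using that by (auto intro: \<iota>_closed weyl_ops.intros)
  have "ad (\<iota> (mulX i)) (\<iota> (mulX j)) = \<zero>" if "i < n" "j < n" for i j
    using that c mulX_commute[of i j] \<iota>_comp[OF weyl_ops.genX weyl_ops.genX]
    by (metis ad_eq_zero_iff)
  moreover have "ad (\<iota> (pderivD i)) (\<iota> (pderivD j)) = \<zero>" if "i < n" "j < n" for i j
    using that c pderivD_commute[of i j] \<iota>_comp[OF weyl_ops.genD weyl_ops.genD]
    by (metis ad_eq_zero_iff)
  moreover have "ad (\<iota> (pderivD i)) (\<iota> (mulX j)) = (if i = j then \<one> else \<zero>)"
    if "i < n" "j < n" for i j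
  proof (rule ad_eqI)
    have w: "mulX j \<in> (weyl_ops n :: 'k op set)" "pderivD i \<in> (weyl_ops n :: 'k op set)" "id \<in> (weyl_ops n :: 'k op set)"
      using that weyl_ops.genX weyl_ops.genD weyl_ops.scal[of 1 n] by (simp_all add: scal_op_1)
    have "\<iota> (pderivD i) \<otimes> \<iota> (mulX j) = \<iota> (pderivD i \<circ> mulX j)"
      using w by (simp add: \<iota>_comp)
    also have "\<dots> = \<iota> (mulX j \<circ> pderivD i) \<oplus> \<iota> (if i = j then id else scal_op 0)"
      unfolding pderivD_mulX using w weyl_ops.comp weyl_ops.scal by (intro \<iota>_add) auto
    also have "\<dots> = \<iota> (mulX j) \<otimes> \<iota> (pderivD i) \<oplus> (if i = j then \<one> else \<zero>)"
      using w k_zero by (simp add: \<iota>_comp \<iota>_id)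
    finally show "\<iota> (pderivD i) \<otimes> \<iota> (mulX j) = \<iota> (mulX j) \<otimes> \<iota> (pderivD i) \<oplus> (if i = j then \<one> else \<zero>)" .
  qed (use that c in auto)
  ultimately show ?thesis using c by (simp add: weyl_system_def)
qed

lemma weyl_ops_gen_alg:
  "S \<in> weyl_ops n \<Longrightarrow> \<iota> S \<in> gen_alg n (\<lambda>i. \<iota> (mulX i)) (\<lambda>i. \<iota> (pderivD i))"
proof (induction rule: weyl_ops.induct)
  case (scal c)
  show ?case by (rule gen_alg.scalar)
next
  case (genX i)
  show ?case by (rule gen_alg.gen_x[OF genX, of "\<lambda>i. \<iota> (mulX i)"])
next
  case (genD i)
  show ?case by (rule gen_alg.gen_d[OF genD, of "\<lambda>i. \<iota> (pderivD i)"])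
next
  case (add S T)
  then show ?case using gen_alg.add by (simp add: \<iota>_add)
next
  case (comp S T)
  show ?case
    unfolding \<iota>_comp[OF comp.hyps] by (rule gen_alg.mult[OF comp.IH])
qed

sublocale weyl_skew D "\<lambda>c. \<iota> (scal_op c)" n "\<lambda>i. \<iota> (mulX i)" "\<lambda>i. \<iota> (pderivD i)"
proof
  show "0 < n" using n_pos by simp
  show "weyl_system n (\<lambda>i. \<iota> (mulX i)) (\<lambda>i. \<iota> (pderivD i))" by (rule weyl_system_\<iota>)
  show "fractions n (\<lambda>i. \<iota> (mulX i)) (\<lambda>i. \<iota> (pderivD i))"
    unfolding fractions_def using fraction_exists weyl_ops_gen_alg by metis
qed

text \<open>The given definition quantifies over all extensions of a permutation. One inclusion
  needs the existence of such an extension, namely \<open>act \<sigma>\<close>; the other needs its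
  uniqueness on the carrier.\<close>

lemma sym_invariants_eq: "sym_invariants n D \<iota> = invariants"
proof (intro equalityI subsetI)
  fix z assume z: "z \<in> sym_invariants n D \<iota>"
  have "act \<sigma> z = z" if "\<sigma> \<in> Sym" for \<sigma>
    using z that act_hom[OF that] act_k[OF that] act_x[OF that] act_d[OF that]
    by (simp add: sym_invariants_def atLeast0LessThan)
  then show "z \<in> invariants"
    using z by (simp add: invariants_def sym_invariants_def)
next
  fix z assume z: "z \<in> invariants"
  then have zc: "z \<in> carrier D" by (simp add: invariants_def)
  have "h z = z"
    if "\<sigma> permutes {0..<n}" "h \<in> ring_hom D D" "\<forall>c. h (\<iota> (scal_op c)) = \<iota> (scal_op c)"
      "\<forall>i<n. h (\<iota> (mulX i)) = \<iota> (mulX (\<sigma> i)) \<and> h (\<iota> (pderivD i)) = \<iota> (pderivD (\<sigma> i))" for \<sigma> h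
  proof -
    have \<sigma>: "\<sigma> \<in> Sym" using that(1) by (simp add: atLeast0LessThan)
    have "h z = act \<sigma> z"
      by (rule weyl_hom_unique[OF weyl frac that(2) act_hom[OF \<sigma>] _ _ _ zc])
        (use that(3,4) act_k[OF \<sigma>] act_x[OF \<sigma>] act_d[OF \<sigma>] in simp_all)
    then show ?thesis using z \<sigma> by (simp add: invariants_def)
  qed
  then show "z \<in> sym_invariants n D \<iota>"
    using zc unfolding sym_invariants_def by blast
qed

end

theorem theorem4p1:
  fixes n :: nat
    and D :: "('b, 'c) ring_scheme"
    and \<iota> :: "'a::field_char_0 op \<Rightarrow> 'b"
  assumes "alg_closed_type TYPE('a)"
    and "n \<ge> 1"
    and "skew_field_of_fractions (weyl_algebra n) D \<iota>"
  shows "k_algebra_iso (\<lambda>c. \<iota> (scal_op c)) (D\<lparr>carrier := sym_invariants n D \<iota>\<rparr>)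
                       (\<lambda>c. \<iota> (scal_op c)) D"
proof -
  interpret weyl_fractions n D \<iota>
    using assms(2,3) by (rule weyl_fractions.intro)
  show ?thesis
    unfolding k_algebra_iso_def sym_invariants_eq by (rule invariants_iso)
qed

end
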